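(* Let $N \ge 1$, $1 \le p < \infty$, and let $u \in L^p(\mathbf{R}^N)$ be nonnegative. Let $(H_n)_{n \ge 1}$ be a sequence in $\breve{\mathcal{H}}_*$ (closed halfspaces of $\mathbf{R}^N$ having $0$ as an interior point). Define $(u_n)_{n\ge 0}$ by \[ \left\{ \begin{aligned} u_0 &= u,\\ u_{n+1} &= u_n^{H_1 H_2 \cdots H_{n+1}} \quad (n \ge 0). \end{aligned} \right. \] If $(H_n)_{n \ge 1}$ is dense in $\mathcal{H}_*$ (the set of closed halfspaces of $\mathbf{R}^N$ containing $0$), then $u_n \to u^*$ in $L^p(\mathbf{R}^N)$ as $n \to \infty$.
   Context: Halfspaces: $\mathcal{H}$ is the set of closed halfspaces of $\mathbf{R}^N$, $\mathcal{H}_* = \{H \in \mathcal{H} : 0 \in H\}$, and $\breve{\mathcal{H}}_* = \{H \in \mathcal{H} : 0 \text{ is an interior point of } H\}$. The topology on $\mathcal{H}$ is the one for which $G_k \to H$ when there are isometries $i_k : \mathbf{R}^N \to \mathbf{R}^N$ with $G_k = i_k(H)$ and $i_k$ converging to the identity as $k \to \infty$ (equivalently, writing a halfspace as $\{x : x\cdot \nu \le t\}$ with $|\nu| = 1$, $t \in \mathbf{R}$, the topology of the parameters $(\nu,t) \in S^{N-1}\times \mathbf{R}$). Density of $(H_n)_{n\ge 1}$ in $\mathcal{H}_*$ means that every $H \in \mathcal{H}_*$ is the limit, in this sense, of halfspaces taken from the sequence. Polarization: for a closed halfspace $H \subset \mathbf{R}^N$, $\sigma_H : \mathbf{R}^N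 \to \mathbf{R}^N$ is the reflection with respect to the hyperplane $\partial H$. The polarization of $u$ with respect to $H$ is the function $u^H$ defined by $u^H(x) = \max(u(x), u(\sigma_H(x)))$ if $x \in H$ and $u^H(x) = \min(u(x), u(\sigma_H(x)))$ if $x \notin H$. Iterated polarizations are applied from left to right: $u^{H_1 H_2 \cdots H_m} = (\cdots((u^{H_1})^{H_2})\cdots)^{H_m}$. Symmetric rearrangement: for nonnegative $u$, $u^* : \mathbf{R}^N \to [0,+\infty]$ is the unique function such that for every $\lambda > 0$ there is $R \ge 0$ with $\{x \in \mathbf{R}^N : u^*(x) > \lambda\} = B(0,R)$ (the open ball of radius $R$ centered at $0$, empty if $R=0$) and $\mathcal{L}^N\{x : u^*(x) > \lambda\} = \mathcal{L}^N\{x : u(x) > \lambda\}$, where $\mathcal{L}^N$ is Lebesgue measure. Functions in $L^p(\mathbf{R}^N)$ are identified when equal almost everywhere. *)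

theory Defs
  imports "HOL-Analysis.Analysis"
begin

definition closed_halfspace :: "'a::euclidean_space set \<Rightarrow> bool" where
  "closed_halfspace H \<longleftrightarrow> (\<exists>\<nu> t. norm \<nu> = 1 \<and> H = {x. x \<bullet> \<nu> \<le> t})"

definition halfspaces_containing_0 :: "'a::euclidean_space set set" where
  "halfspaces_containing_0 = {H. closed_halfspace H \<and> 0 \<in> H}"

definition halfspaces_around_0 :: "'a::euclidean_space set set" where
  "halfspaces_around_0 = {H. closed_halfspace H \<and> 0 \<in> interior H}"

text \<open>Convergence of the isometries to the identity is pointwise, which for isometries is the same
  as locally uniform convergence. An isometry of a Euclidean space into itself is onto.\<close>

definition halfspace_tendsto :: "(nat \<Rightarrow> 'a::euclidean_space set) \<Rightarrow> 'a set \<Rightarrow> bool" where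
  "halfspace_tendsto G H \<longleftrightarrow>
     (\<exists>i :: nat \<Rightarrow> 'a \<Rightarrow> 'a.
        (\<forall>k x y. dist (i k x) (i k y) = dist x y) \<and>
        (\<forall>k. G k = i k ` H) \<and>
        (\<forall>x. (\<lambda>k. i k x) \<longlonglongrightarrow> x))"

definition halfspaces_dense :: "'a::euclidean_space set set \<Rightarrow> 'a set set \<Rightarrow> bool" where
  "halfspaces_dense D K \<longleftrightarrow> (\<forall>H\<in>K. \<exists>G. (\<forall>k. G k \<in> D) \<and> halfspace_tendsto G H)"

text \<open>The reflection in the hyperplane bounding \<open>H\<close> sends \<open>x\<close> to \<open>2 P x - x\<close>, where \<open>P\<close> is the
  nearest-point projection onto that hyperplane.\<close>

definition reflection :: "'a::euclidean_space set \<Rightarrow> 'a \<Rightarrow> 'a" where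
  "reflection H x = 2 *\<^sub>R closest_point (frontier H) x - x"

lemma reflection_halfspace:
  fixes \<nu> :: "'a::euclidean_space"
  assumes "norm \<nu> = 1"
  shows "reflection {x. x \<bullet> \<nu> \<le> t} x = x - (2 * (x \<bullet> \<nu> - t)) *\<^sub>R \<nu>"
proof -
  have nn: "\<nu> \<bullet> \<nu> = 1"
    using assms by (simp add: dot_square_norm)
  have fr: "frontier {x. x \<bullet> \<nu> \<le> t} = {x. \<nu> \<bullet> x = t}"
  proof -
    have "\<nu> \<noteq> 0"
      using assms by auto
    then show ?thesis
      using frontier_halfspace_le[of \<nu> t] by (simp add: inner_commute)
  qed
  define y where "y = x - (x \<bullet> \<nu> - t) *\<^sub>R \<nu>"
  have "y = closest_point {x. \<nu> \<bullet> x = t} x"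
  proof (rule closest_point_unique)
    show "convex {x. \<nu> \<bullet> x = t}" "closed {x. \<nu> \<bullet> x = t}"
      by (auto simp: convex_hyperplane closed_hyperplane)
    show "y \<in> {x. \<nu> \<bullet> x = t}"
      by (simp add: y_def inner_diff_right nn inner_commute)
    show "\<forall>z\<in>{x. \<nu> \<bullet> x = t}. dist x y \<le> dist x z"
    proof
      fix z assume "z \<in> {x. \<nu> \<bullet> x = t}"
      then have "\<bar>x \<bullet> \<nu> - t\<bar> = \<bar>(x - z) \<bullet> \<nu>\<bar>"
        by (simp add: inner_diff_left inner_diff_right inner_commute)
      also have "\<dots> \<le> norm (x - z)"
        using Cauchy_Schwarz_ineq2[of "x - z" \<nu>] assms by simp
      finally show "dist x y \<le> dist x z"
        using assms by (simp add: y_def dist_norm)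
    qed
  qed
  then have "reflection {x. x \<bullet> \<nu> \<le> t} x = 2 *\<^sub>R y - x"
    by (simp add: reflection_def fr)
  also have "\<dots> = x - (2 * (x \<bullet> \<nu> - t)) *\<^sub>R \<nu>"
    unfolding y_def scaleR_diff_right scaleR_scaleR by (simp add: scaleR_2)
  finally show ?thesis .
qed

definition polarize :: "'a::euclidean_space set \<Rightarrow> ('a \<Rightarrow> real) \<Rightarrow> 'a \<Rightarrow> real" where
  "polarize H u x =
     (if x \<in> H then max (u x) (u (reflection H x)) else min (u x) (u (reflection H x)))"

text \<open>\<open>fold\<close> applies the polarization in the head of the list first.\<close>

definition polarize_list :: "'a::euclidean_space set list \<Rightarrow> ('a \<Rightarrow> real) \<Rightarrow> 'a \<Rightarrow> real" where
  "polarize_list Hs u = fold polarize Hs u"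

definition is_symmetric_rearrangement ::
    "('a::euclidean_space \<Rightarrow> real) \<Rightarrow> ('a \<Rightarrow> ennreal) \<Rightarrow> bool" where
  "is_symmetric_rearrangement u v \<longleftrightarrow>
     (\<forall>l::real. 0 < l \<longrightarrow>
        (\<exists>R\<ge>0. {x. ennreal l < v x} = ball 0 R) \<and>
        emeasure lebesgue {x. ennreal l < v x} = emeasure lebesgue {x. l < u x})"

definition symmetric_rearrangement ::
    "('a::euclidean_space \<Rightarrow> real) \<Rightarrow> 'a \<Rightarrow> ennreal" where
  "symmetric_rearrangement u = (THE v. is_symmetric_rearrangement u v)"

definition in_Lp :: "real \<Rightarrow> ('a::euclidean_space \<Rightarrow> real) \<Rightarrow> bool" where
  "in_Lp p f \<longleftrightarrow>
     f \<in> borel_measurable lebesgue \<and> integrable lebesgue (\<lambda>x. \<bar>f x\<bar> powr p)"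

definition Lp_norm :: "real \<Rightarrow> ('a::euclidean_space \<Rightarrow> real) \<Rightarrow> real" where
  "Lp_norm p f = (\<integral>x. \<bar>f x\<bar> powr p \<partial>lebesgue) powr (1 / p)"

definition Lp_tendsto ::
    "real \<Rightarrow> (nat \<Rightarrow> 'a::euclidean_space \<Rightarrow> real) \<Rightarrow> ('a \<Rightarrow> real) \<Rightarrow> bool" where
  "Lp_tendsto p f g \<longleftrightarrow>
     (\<forall>n. in_Lp p (f n)) \<and> in_Lp p g \<and> (\<lambda>n. Lp_norm p (\<lambda>x. f n x - g x)) \<longlonglongrightarrow> 0"

text \<open>Convergence in \<open>L\<^sup>p\<close> to an extended-valued limit: \<open>g\<close> has to be finite almost everywhere, so
  that \<open>enn2real\<close>, which sends \<open>\<infinity>\<close> to \<open>0\<close>, changes it on a null set only.\<close>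

definition Lp_tendsto_ennreal ::
    "real \<Rightarrow> (nat \<Rightarrow> 'a::euclidean_space \<Rightarrow> real) \<Rightarrow> ('a \<Rightarrow> ennreal) \<Rightarrow> bool" where
  "Lp_tendsto_ennreal p f g \<longleftrightarrow>
     (AE x in lebesgue. g x \<noteq> \<infinity>) \<and> Lp_tendsto p f (\<lambda>x. enn2real (g x))"

end

theory Submission
  imports Defs "HOL-Complex_Analysis.Great_Picard"
begin

text \<open>For a Lipschitz function with compact support the whole orbit of polarizations is relatively
compact in the uniform norm: a polarization with respect to a halfspace containing the origin keeps
the Lipschitz constant, the bounds and the supporting ball (\<open>lipschitz_bump_polarize\<close>), so
Arzela-Ascoli applies. The second moment of the function about the origin is a Lyapunov function.
It does not increase under such a polarization, and if the origin is interior to the halfspace it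
stays the same only if the function does not change (\<open>second_moment_polarize_eq\<close>). Let \<open>w\<close> be the
limit of a subsequence. As \<open>u\<^sub>n\<^sub>+\<^sub>1\<close> comes from \<open>u\<^sub>n\<close> by the polarizations \<open>H\<^sub>1, H\<^sub>2, \<dots>\<close> in this order,
every prefix \<open>H\<^sub>1 \<dots> H\<^sub>j\<close> applied to \<open>w\<close> leaves its second moment unchanged, and by induction on \<open>j\<close>
each \<open>H\<^sub>j\<close> fixes \<open>w\<close>. Polarization does not expand uniform distances, so the distance from \<open>u\<^sub>n\<close> to
the fixed function \<open>w\<close> does not increase and the whole sequence converges to \<open>w\<close> (\<open>bump_sweeps_limit\<close>). By
density \<open>w\<close> is compatible with the halfspace bounded by the bisector of any two points, which says
that \<open>w\<close> is a decreasing function of the norm (\<open>polarize_invariant_radially_antimono\<close>).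

The general case is a statement about sets. Superlevel sets of a polarized function are polarized
sets, and polarizing a set keeps its measure and respects inclusion. A compact set \<open>K\<close> is the level
set \<open>{f \<ge> 1}\<close> of a Lipschitz bump \<open>f\<close>, and uniform convergence of the polarizations of \<open>f\<close> traps those
of \<open>K\<close> in balls whose measure is close to that of \<open>K\<close>; inner approximation by compact sets then gives
every set of finite measure (\<open>sweeps_set_sym_diff_tendsto\<close>). Applied to \<open>{u > l}\<close> this says that for
each \<open>l > 0\<close> the superlevel sets of \<open>u\<^sub>n\<close> converge in measure to the ball \<open>{u\<^sup>* > l}\<close>. Because of
\<open>\<bar>a - b\<bar>\<^sup>p \<le> \<bar>a\<^sup>p - b\<^sup>p\<bar>\<close> the \<open>p\<close>-th power of the distance from \<open>u\<^sub>n\<close> to \<open>u\<^sup>*\<close> is at most the integral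
of the measures of the symmetric differences of superlevel sets, and dominated convergence finishes
the proof (\<open>Lp_norm_tendsto_zero_of_levels\<close>).\<close>

section \<open>Reflections preserve Lebesgue measure\<close>

text \<open>Both sides are the double integral of \<open>1\<^sub>A(x) 1\<^sub>B(x + y)\<close>, with the translation invariance of one
measure or of the other used in the inner integral. With a fixed \<open>B\<close> of finite positive measure the
identity says that a translation-invariant measure is a multiple of Lebesgue measure, up to the
reflection in the origin.\<close>

lemma emeasure_translation_invariant_convolution:
  fixes M :: "'a::euclidean_space measure"
  assumes fin: "sigma_finite_measure M" and sets: "sets M = sets borel"
    and inv: "\<And>c. distr M borel ((+) c) = M"
    and A [measurable]: "A \<in> sets borel" and B [measurable]: "B \<in> sets borel"
  shows "emeasure lborel B * emeasure M A = emeasure M B * emeasure lborel (uminus -` A)"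
proof -
  have [measurable_cong]: "sets M = sets borel" by (rule sets)
  have spM [simp]: "space M = UNIV"
    using sets_eq_imp_space_eq[OF sets] by simp
  interpret M: sigma_finite_measure M by (rule fin)
  interpret P: pair_sigma_finite lborel M ..
  let ?I = "indicator :: 'a set \<Rightarrow> 'a \<Rightarrow> ennreal"
  have "emeasure lborel B * emeasure M A = (\<integral>\<^sup>+x. emeasure lborel B * ?I A x \<partial>M)"
    using A sets by (subst nn_integral_cmult) (auto simp: mult.commute)
  also have "\<dots> = (\<integral>\<^sup>+x. (\<integral>\<^sup>+y. ?I A x * ?I B (x + y) \<partial>lborel) \<partial>M)"
  proof (rule nn_integral_cong)
    fix x :: 'a
    have "(\<integral>\<^sup>+y. ?I A x * ?I B (x + y) \<partial>lborel) = ?I A x * (\<integral>\<^sup>+y. ?I B (x + y) \<partial>lborel)"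
      by (rule nn_integral_cmult) simp
    also have "(\<integral>\<^sup>+y. ?I B (x + y) \<partial>lborel) = (\<integral>\<^sup>+y. ?I B y \<partial>distr lborel borel ((+) x))"
      by (subst nn_integral_distr) auto
    also have "\<dots> = emeasure lborel B"
      by (simp add: lborel_distr_plus)
    finally show "emeasure lborel B * ?I A x = (\<integral>\<^sup>+y. ?I A x * ?I B (x + y) \<partial>lborel)"
      by (simp add: mult.commute)
  qed
  also have "\<dots> = (\<integral>\<^sup>+y. (\<integral>\<^sup>+x. ?I A x * ?I B (x + y) \<partial>M) \<partial>lborel)"
    by (rule P.Fubini') simp
  also have "\<dots> = (\<integral>\<^sup>+y. (\<integral>\<^sup>+x. ?I A (x - y) * ?I B x \<partial>M) \<partial>lborel)"
  proof (rule nn_integral_cong)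
    fix y :: 'a
    have "(\<integral>\<^sup>+x. ?I A (x - y) * ?I B x \<partial>M) = (\<integral>\<^sup>+x. ?I A (x - y) * ?I B x \<partial>distr M borel ((+) y))"
      by (simp add: inv)
    also have "\<dots> = (\<integral>\<^sup>+x. ?I A x * ?I B (x + y) \<partial>M)"
      by (subst nn_integral_distr) (auto simp: add.commute)
    finally show "(\<integral>\<^sup>+x. ?I A x * ?I B (x + y) \<partial>M) = (\<integral>\<^sup>+x. ?I A (x - y) * ?I B x \<partial>M)" ..
  qed
  also have "\<dots> = (\<integral>\<^sup>+x. (\<integral>\<^sup>+y. ?I A (x - y) * ?I B x \<partial>lborel) \<partial>M)"
    by (rule P.Fubini'[symmetric]) simp
  also have "\<dots> = (\<integral>\<^sup>+x. ?I B x * emeasure lborel (uminus -` A) \<partial>M)"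
  proof (rule nn_integral_cong)
    fix x :: 'a
    have [measurable]: "uminus -` A \<in> sets borel"
      using measurable_sets[of uminus borel borel A] by simp
    have "(\<integral>\<^sup>+y. ?I A (x - y) * ?I B x \<partial>lborel) = ?I B x * (\<integral>\<^sup>+y. ?I A (x - y) \<partial>lborel)"
      by (subst mult.commute, rule nn_integral_cmult) simp
    also have "(\<integral>\<^sup>+y. ?I A (x - y) \<partial>lborel) = (\<integral>\<^sup>+y. ?I A (x - y) \<partial>distr lborel borel ((+) x))"
      by (simp add: lborel_distr_plus)
    also have "\<dots> = (\<integral>\<^sup>+y. ?I A (x - (x + y)) \<partial>lborel)"
      by (subst nn_integral_distr) simp_all
    also have "(\<lambda>y. ?I A (x - (x + y))) = ?I (uminus -` A)"
      by (auto simp: fun_eq_iff indicator_def)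
    also have "integral\<^sup>N lborel \<dots> = emeasure lborel (uminus -` A)"
      by (rule nn_integral_indicator) simp
    finally show "(\<integral>\<^sup>+y. ?I A (x - y) * ?I B x \<partial>lborel) = ?I B x * emeasure lborel (uminus -` A)" .
  qed
  also have "\<dots> = emeasure M B * emeasure lborel (uminus -` A)"
    using B sets by (subst nn_integral_multc) auto
  finally show ?thesis .
qed

text \<open>The image measure is translation-invariant and, since \<open>T\<close> preserves norms, agrees with Lebesgue
measure on balls about the origin. The preceding identity with \<open>B\<close> the unit ball, read once for the
image measure and once for Lebesgue measure itself, therefore has the same right-hand side.\<close>

lemma distr_lborel_orthogonal_transformation:
  fixes T :: "'a::euclidean_space \<Rightarrow> 'a"
  assumes T: "orthogonal_transformation T"
  shows "distr lborel borel T = lborel"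
proof -
  have lin: "linear T"
    using T by (rule orthogonal_transformation_linear)
  have [measurable]: "T \<in> borel \<rightarrow>\<^sub>M borel"
    using lin by (intro borel_measurable_continuous_onI linear_continuous_on) (simp add: linear_conv_bounded_linear)
  define M where "M = distr lborel borel T"
  have setsM: "sets M = sets borel" "space M = UNIV"
    by (auto simp: M_def)
  have inv: "distr M borel ((+) c) = M" for c
  proof -
    obtain d where d: "c = T d"
      using orthogonal_transformation_surj[OF T] by (metis surjD)
    have "distr M borel ((+) c) = distr lborel borel (\<lambda>x. T (d + x))"
      by (simp add: M_def distr_distr o_def d linear_add[OF lin])
    also have "\<dots> = distr (distr lborel borel ((+) d)) borel T"
      by (simp add: distr_distr o_def)
    finally show ?thesis
      by (simp add: lborel_distr_plus M_def)
  qed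
  have ball: "emeasure M (ball 0 r) = emeasure lborel (ball (0::'a) r)" for r
  proof -
    have "T -` ball 0 r = ball 0 r"
      using orthogonal_transformation_norm[OF T] by auto
    then show ?thesis
      by (simp add: M_def emeasure_distr)
  qed
  have "sigma_finite_measure M"
  proof
    show "\<exists>A. countable A \<and> A \<subseteq> sets M \<and> \<Union>A = space M \<and> (\<forall>a\<in>A. emeasure M a \<noteq> \<infinity>)"
    proof (intro exI conjI ballI)
      show "countable (range (\<lambda>n::nat. ball (0::'a) n))" by simp
      show "range (\<lambda>n::nat. ball (0::'a) n) \<subseteq> sets M" by (auto simp: setsM)
      show "\<Union>(range (\<lambda>n::nat. ball (0::'a) n)) = space M"
        using reals_Archimedean2 by (auto simp: setsM)
      show "emeasure M a \<noteq> \<infinity>" if "a \<in> range (\<lambda>n::nat. ball (0::'a) n)" for a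
        using that ball emeasure_lborel_ball_finite by (fastforce simp: less_top[symmetric])
    qed
  qed
  note conv = emeasure_translation_invariant_convolution[OF this setsM(1) inv]
  note convL = emeasure_translation_invariant_convolution[OF sigma_finite_lborel sets_lborel lborel_distr_plus]
  have "M = lborel"
  proof (rule measure_eqI)
    show "sets M = sets lborel" by (simp add: setsM)
    fix A assume "A \<in> sets M"
    then have A: "A \<in> sets borel" by (simp add: setsM)
    let ?b = "emeasure lborel (ball (0::'a) 1)"
    have "?b * emeasure M A = ?b * emeasure lborel A"
      using conv[OF A, of "ball 0 1"] convL[OF A, of "ball 0 1"] by (simp add: ball)
    moreover have "?b \<noteq> 0" "?b \<noteq> \<infinity>"
      using open_not_negligible[of "ball (0::'a) 1"] emeasure_lborel_ball_finite[of "0::'a" 1]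
      by (auto simp: negligible_iff_emeasure0)
    ultimately show "emeasure M A = emeasure lborel A"
      by (simp add: ennreal_mult_cancel_left)
  qed
  then show ?thesis by (simp add: M_def)
qed

lemma closed_halfspace_cases:
  assumes "closed_halfspace H"
  obtains \<nu> t where "norm \<nu> = 1" "H = {x. x \<bullet> \<nu> \<le> t}" "\<nu> \<bullet> \<nu> = 1"
    "\<And>x. reflection H x = x - (2 * (x \<bullet> \<nu> - t)) *\<^sub>R \<nu>"
    "\<And>x. reflection H x \<bullet> \<nu> = 2 * t - x \<bullet> \<nu>"
proof -
  obtain \<nu> t where n: "norm \<nu> = 1" "H = {x. x \<bullet> \<nu> \<le> t}"
    using assms by (auto simp: closed_halfspace_def)
  then have nn: "\<nu> \<bullet> \<nu> = 1" by (simp add: dot_square_norm)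
  have r: "reflection H x = x - (2 * (x \<bullet> \<nu> - t)) *\<^sub>R \<nu>" for x
    using reflection_halfspace[OF n(1)] n(2) by simp
  show ?thesis
    by (rule that[OF n nn r]) (simp add: r inner_diff_left nn algebra_simps)
qed

lemma halfspaces_around_0_D:
  assumes "H \<in> halfspaces_around_0"
  shows "closed_halfspace H" "0 \<in> H"
  using assms interior_subset by (auto simp: halfspaces_around_0_def)

context
  fixes H :: "'a::euclidean_space set"
  assumes H: "closed_halfspace H"
begin

lemma reflection_reflection [simp]: "reflection H (reflection H x) = x"
proof (rule closed_halfspace_cases[OF H])
  fix \<nu> t
  assume r: "\<And>x. reflection H x = x - (2 * (x \<bullet> \<nu> - t)) *\<^sub>R \<nu>"
    and i: "\<And>x. reflection H x \<bullet> \<nu> = 2 * t - x \<bullet> \<nu>"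
  show ?thesis
    by (subst r, simp only: i) (simp add: r algebra_simps)
qed

lemma dist_reflection [simp]: "dist (reflection H x) (reflection H y) = dist x y"
proof (rule closed_halfspace_cases[OF H])
  fix \<nu> t
  assume nn: "\<nu> \<bullet> \<nu> = 1" and r: "\<And>x. reflection H x = x - (2 * (x \<bullet> \<nu> - t)) *\<^sub>R \<nu>"
  define z where "z = x - y"
  have "reflection H x - reflection H y = z - (2 * (z \<bullet> \<nu>)) *\<^sub>R \<nu>"
    by (simp add: r z_def inner_diff_left algebra_simps)
  moreover have "(z - (2 * (z \<bullet> \<nu>)) *\<^sub>R \<nu>) \<bullet> (z - (2 * (z \<bullet> \<nu>)) *\<^sub>R \<nu>) = z \<bullet> z"
    by (simp add: inner_diff_left inner_diff_right nn inner_commute algebra_simps)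
  ultimately show ?thesis
    by (simp add: dist_norm norm_eq_sqrt_inner z_def)
qed

lemma dist_reflection_commute: "dist (reflection H x) y = dist x (reflection H y)"
  using dist_reflection[of x "reflection H y"] by simp

text \<open>Two points on opposite sides of the hyperplane come closer when one of them is reflected to the side
of the other. This is why polarization does not increase Lipschitz constants.\<close>

lemma dist_reflection_le:
  assumes "x \<in> H" "y \<notin> H"
  shows "dist x (reflection H y) \<le> dist x y"
proof (rule closed_halfspace_cases[OF H])
  fix \<nu> t
  assume h: "H = {x. x \<bullet> \<nu> \<le> t}"
    and nn: "\<nu> \<bullet> \<nu> = 1" and r: "\<And>x. reflection H x = x - (2 * (x \<bullet> \<nu> - t)) *\<^sub>R \<nu>"
  define s where "s = y \<bullet> \<nu> - t"
  have s: "s > 0" "x \<bullet> \<nu> \<le> t"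
    using assms by (auto simp: h s_def)
  have "(x - reflection H y) \<bullet> (x - reflection H y) = (x - y) \<bullet> (x - y) + 4 * (s * (x \<bullet> \<nu> - t))"
    by (simp add: r s_def[symmetric] inner_diff_left inner_diff_right inner_add_left inner_add_right nn inner_commute algebra_simps)
       (simp add: s_def algebra_simps inner_commute)
  also have "\<dots> \<le> (x - y) \<bullet> (x - y)"
    using s by (simp add: mult_nonneg_nonpos)
  finally show ?thesis
    by (simp add: dist_norm norm_eq_sqrt_inner)
qed

lemma reflection_in_halfspace: "x \<notin> H \<Longrightarrow> reflection H x \<in> H"
  by (rule closed_halfspace_cases[OF H]) simp

lemma reflection_notin_halfspace: "x \<in> H \<Longrightarrow> reflection H x \<notin> H \<or> reflection H x = x"
  by (rule closed_halfspace_cases[OF H]) auto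

lemma norm_reflection_ge:
  assumes "0 \<in> H" "x \<in> H"
  shows "norm x \<le> norm (reflection H x)"
proof (cases "reflection H x \<in> H")
  case True
  then show ?thesis
    using reflection_notin_halfspace[of x] assms by auto
next
  case False
  then show ?thesis
    using dist_reflection_le[of 0 "reflection H x"] assms by simp
qed

lemma norm_reflection_le:
  assumes "0 \<in> H" "x \<notin> H"
  shows "norm (reflection H x) \<le> norm x"
  using norm_reflection_ge[of "reflection H x"] reflection_in_halfspace[of x] assms by simp

lemma closed_halfspace_lebesgue: "H \<in> sets lebesgue"
proof (rule closed_halfspace_cases[OF H])
  fix \<nu> t
  assume h: "H = {x. x \<bullet> \<nu> \<le> t}"
  have "closed H"
    using closed_halfspace_le[of \<nu> t] by (simp add: h inner_commute)
  then show ?thesis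
    by (simp add: borel_closed)
qed

lemma null_sets_reflection_fixed: "{x. reflection H x = x} \<in> null_sets lebesgue"
proof (rule closed_halfspace_cases[OF H])
  fix \<nu> t
  assume nu: "norm \<nu> = 1" and r: "\<And>x. reflection H x = x - (2 * (x \<bullet> \<nu> - t)) *\<^sub>R \<nu>"
  have "{x. reflection H x = x} = {x. \<nu> \<bullet> x = t}"
    using nu by (auto simp: r inner_commute)
  then show ?thesis
    using negligible_hyperplane[of \<nu> t] nu
    by (simp only: negligible_iff_null_sets) force
qed

lemma distr_lborel_reflection: "distr lborel borel (reflection H) = lborel"
proof (rule closed_halfspace_cases[OF H])
  fix \<nu> t
  assume nn: "\<nu> \<bullet> \<nu> = 1" and r: "\<And>x. reflection H x = x - (2 * (x \<bullet> \<nu> - t)) *\<^sub>R \<nu>"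
  define T where "T = (\<lambda>x. x - (2 * (x \<bullet> \<nu>)) *\<^sub>R \<nu>)"
  have rT: "reflection H = (\<lambda>x. (2 * t) *\<^sub>R \<nu> + T x)"
    by (auto simp: r T_def algebra_simps)
  have "orthogonal_transformation T"
    unfolding orthogonal_transformation_isometry
  proof (intro conjI allI)
    show "T 0 = 0" by (simp add: T_def)
    show "dist (T x) (T y) = dist x y" for x y
      using dist_reflection[of x y] by (simp add: rT)
  qed
  then have "distr lborel borel T = lborel"
    by (rule distr_lborel_orthogonal_transformation)
  moreover have "T \<in> borel_measurable borel"
    unfolding T_def by measurable
  ultimately show ?thesis
    using lborel_distr_plus[of "(2 * t) *\<^sub>R \<nu>"] distr_distr[of "(+) ((2 * t) *\<^sub>R \<nu>)" borel borel T lborel]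
    by (simp add: rT o_def)
qed

lemma reflection_borel_measurable: "reflection H \<in> borel \<rightarrow>\<^sub>M borel"
  by (rule closed_halfspace_cases[OF H]) (simp cong: measurable_cong)

lemma distr_lebesgue_reflection: "distr lebesgue lebesgue (reflection H) = lebesgue"
    and reflection_lebesgue_measurable: "reflection H \<in> lebesgue \<rightarrow>\<^sub>M lebesgue"
proof -
  have m: "reflection H \<in> lebesgue \<rightarrow>\<^sub>M lborel"
    using reflection_borel_measurable by (simp add: measurable_completion)
  have d: "distr lebesgue lborel (reflection H) = lborel"
    using distr_lborel_reflection reflection_borel_measurable by (simp add: distr_completion cong: distr_cong)
  show "distr lebesgue lebesgue (reflection H) = lebesgue"
    using completion.completion_distr_eq[OF m] by (simp add: d)
  show "reflection H \<in> lebesgue \<rightarrow>\<^sub>M lebesgue"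
    by (rule completion.measurable_completion2[OF m]) (simp add: d)
qed

lemma vimage_reflection_lebesgue:
  "A \<in> sets lebesgue \<Longrightarrow> reflection H -` A \<in> sets lebesgue"
  using measurable_sets[OF reflection_lebesgue_measurable, of A] by simp

lemma emeasure_vimage_reflection:
  assumes "A \<in> sets lebesgue"
  shows "emeasure lebesgue (reflection H -` A) = emeasure lebesgue A"
  using emeasure_distr[OF reflection_lebesgue_measurable assms]
  by (simp add: distr_lebesgue_reflection)

end

text \<open>The reflection is defined by the metric alone, so isometries conjugate reflections. Density of
halfspaces is expressed by isometries, and this makes it usable without parameters for the
approximating halfspaces.\<close>

lemma reflection_isometry_image:
  fixes i :: "'a::euclidean_space \<Rightarrow> 'a"
  assumes i: "\<And>x y. dist (i x) (i y) = dist x y" and H: "closed_halfspace H"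
  shows "reflection (i ` H) (i x) = i (reflection H x)"
proof (rule closed_halfspace_cases[OF H])
  fix \<nu> t
  assume nu: "norm \<nu> = 1" and h: "H = {x. x \<bullet> \<nu> \<le> t}"
    and r: "\<And>x. reflection H x = x - (2 * (x \<bullet> \<nu> - t)) *\<^sub>R \<nu>"
  define T where "T = (\<lambda>x. i x - i 0)"
  have iT: "i x = T x + i 0" for x
    by (simp add: T_def)
  have T: "orthogonal_transformation T"
    unfolding orthogonal_transformation_isometry using i by (simp add: T_def dist_norm)
  have inner: "T x \<bullet> T y = x \<bullet> y" for x y
    using T by (simp add: orthogonal_transformation_def)
  have lin: "linear T"
    using T by (rule orthogonal_transformation_linear)
  have "i ` H = {y. y \<bullet> T \<nu> \<le> t + i 0 \<bullet> T \<nu>}"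
  proof (intro set_eqI iffI)
    fix y assume "y \<in> i ` H"
    then obtain x where "y = T x + i 0" "x \<bullet> \<nu> \<le> t"
      by (auto simp: h T_def)
    then show "y \<in> {y. y \<bullet> T \<nu> \<le> t + i 0 \<bullet> T \<nu>}"
      by (simp add: inner_add_left inner)
  next
    fix y assume y: "y \<in> {y. y \<bullet> T \<nu> \<le> t + i 0 \<bullet> T \<nu>}"
    obtain x where x: "y - i 0 = T x"
      using orthogonal_transformation_surj[OF T] by (metis surjD)
    then have yx: "y = i x"
      by (simp add: T_def)
    have "T x \<bullet> T \<nu> \<le> t"
      using y by (simp add: x[symmetric] inner_diff_left)
    then show "y \<in> i ` H"
      by (auto simp: yx h inner)
  qed
  moreover have "norm (T \<nu>) = 1"
    using orthogonal_transformation_norm[OF T] nu by simp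
  ultimately have "reflection (i ` H) (i x) = i x - (2 * (i x \<bullet> T \<nu> - (t + i 0 \<bullet> T \<nu>))) *\<^sub>R T \<nu>"
    by (simp only: reflection_halfspace)
  also have "i x \<bullet> T \<nu> = x \<bullet> \<nu> + i 0 \<bullet> T \<nu>"
    by (subst iT[of x]) (simp add: inner_add_left inner)
  also have "i x - (2 * (x \<bullet> \<nu> + i 0 \<bullet> T \<nu> - (t + i 0 \<bullet> T \<nu>))) *\<^sub>R T \<nu>
      = T (x - (2 * (x \<bullet> \<nu> - t)) *\<^sub>R \<nu>) + i 0"
    by (subst iT[of x]) (simp add: linear_diff[OF lin] linear_scale[OF lin])
  also have "\<dots> = i (reflection H x)"
    by (simp only: r iT[symmetric])
  finally show ?thesis .
qed

section \<open>Polarized sets and iterated sweeps\<close>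

text \<open>These are the superlevel sets of polarized functions (\<open>upward_closed_polarize\<close>). Working with them
reduces measure-theoretic questions on polarized functions to sets.\<close>

definition polarize_set :: "'a::euclidean_space set \<Rightarrow> 'a set \<Rightarrow> 'a set" where
  "polarize_set H A =
     {x. if x \<in> H then x \<in> A \<or> reflection H x \<in> A else x \<in> A \<and> reflection H x \<in> A}"

text \<open>An upward closed property holds for a maximum if it holds for one of the two values, and for a
minimum if it holds for both. With a property \<open>Q\<close> in place of a level this covers strict and
non-strict superlevel sets.\<close>

lemma upward_closed_polarize:
  assumes "\<And>a b. Q a \<Longrightarrow> a \<le> b \<Longrightarrow> Q b"
  shows "{x. Q (polarize H f x)} = polarize_set H {x. Q (f x)}"
proof -
  have "Q (max a b) \<longleftrightarrow> Q a \<or> Q b" "Q (min a b) \<longleftrightarrow> Q a \<and> Q b" for a b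
    using assms[of a b] assms[of b a] by (auto simp: max_def min_def)
  then show ?thesis
    by (auto simp: polarize_def polarize_set_def)
qed

lemma polarize_set_mono: "A \<subseteq> B \<Longrightarrow> polarize_set H A \<subseteq> polarize_set H B"
  by (auto simp: polarize_set_def)

lemma polarize_set_lebesgue:
  assumes "closed_halfspace H" "A \<in> sets lebesgue"
  shows "polarize_set H A \<in> sets lebesgue"
proof -
  have "polarize_set H A = (H \<inter> (A \<union> reflection H -` A)) \<union> (A \<inter> reflection H -` A - H)"
    by (auto simp: polarize_set_def)
  then show ?thesis
    using assms by (simp add: sets.Un sets.Int sets.Diff closed_halfspace_lebesgue vimage_reflection_lebesgue)
qed

text \<open>Let \<open>A'\<close> be the mirror image of \<open>A\<close>. The polarized set is \<open>A \<union> A'\<close> inside \<open>H\<close> and \<open>A \<inter> A'\<close> outside. The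
reflection moves the latter part into \<open>H\<close>, up to the null set of fixed points, so the total measure
is that of \<open>H \<inter> A\<close> plus that of \<open>H \<inter> A'\<close>, and the second summand is the measure of \<open>A - H\<close>.\<close>

lemma emeasure_polarize_set:
  fixes H :: "'a::euclidean_space set"
  assumes H: "closed_halfspace H" and A [measurable]: "A \<in> sets lebesgue"
  shows "emeasure lebesgue (polarize_set H A) = emeasure lebesgue A"
proof -
  let ?s = "reflection H" and ?\<mu> = "emeasure (lebesgue :: 'a measure)"
  note [measurable] = closed_halfspace_lebesgue[OF H] vimage_reflection_lebesgue[OF H]
  have swap: "?\<mu> (X - H) = ?\<mu> (H \<inter> ?s -` X)" if [measurable]: "X \<in> sets lebesgue" for X
  proof -
    have "?\<mu> (X - H) = ?\<mu> (?s -` (X - H))"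
      by (rule emeasure_vimage_reflection[OF H, symmetric]) simp
    also have "\<dots> = ?\<mu> (H \<inter> ?s -` X)"
    proof (rule emeasure_eq_AE)
      have "AE x in lebesgue. ?s x \<noteq> x"
        using AE_not_in[OF null_sets_reflection_fixed[OF H]] by simp
      then show "AE x in lebesgue. x \<in> ?s -` (X - H) \<longleftrightarrow> x \<in> H \<inter> ?s -` X"
      proof eventually_elim
        case (elim x)
        then show ?case
          using reflection_in_halfspace[OF H, of x] reflection_notin_halfspace[OF H, of x] by auto
      qed
    qed simp_all
    finally show ?thesis .
  qed
  have ss: "?s -` ?s -` A = A"
    using reflection_reflection[OF H] by auto
  have "?\<mu> (polarize_set H A) = ?\<mu> ((H \<inter> (A \<union> ?s -` A)) \<union> (A \<inter> ?s -` A - H))"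
    by (rule arg_cong[of _ _ ?\<mu>]) (auto simp: polarize_set_def)
  also have "\<dots> = ?\<mu> (H \<inter> (A \<union> ?s -` A)) + ?\<mu> (A \<inter> ?s -` A - H)"
    by (rule plus_emeasure[symmetric]) auto
  also have "?\<mu> (A \<inter> ?s -` A - H) = ?\<mu> ((H \<inter> A) \<inter> (H \<inter> ?s -` A))"
    by (subst swap) (auto simp: ss simp del: emeasure_completion intro!: arg_cong[of _ _ ?\<mu>])
  also have "H \<inter> (A \<union> ?s -` A) = (H \<inter> A) \<union> (H \<inter> ?s -` A)"
    by blast
  also have "?\<mu> ((H \<inter> A) \<union> (H \<inter> ?s -` A)) + ?\<mu> ((H \<inter> A) \<inter> (H \<inter> ?s -` A))
      = ?\<mu> (H \<inter> A) + ?\<mu> (H \<inter> ?s -` A)"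
    by (rule emeasure_Un_Int[symmetric]) auto
  also have "\<dots> = ?\<mu> (H \<inter> A) + ?\<mu> (A - H)"
    by (simp only: swap[OF A])
  also have "\<dots> = ?\<mu> ((H \<inter> A) \<union> (A - H))"
    by (rule plus_emeasure) auto
  also have "(H \<inter> A) \<union> (A - H) = A"
    by blast
  finally show ?thesis .
qed

text \<open>One sweep applies the operations of \<open>H 1\<close>, \<dots>, \<open>H m\<close> in this order; the sequence of the theorem makes
a sweep of length \<open>n + 1\<close> in step \<open>n + 1\<close>. The operation is a parameter so that functions and sets run
through the same iteration and \<open>sweeps_rel\<close> carries relations between the two.\<close>

primrec sweep :: "('h \<Rightarrow> 'b \<Rightarrow> 'b) \<Rightarrow> (nat \<Rightarrow> 'h) \<Rightarrow> 'b \<Rightarrow> nat \<Rightarrow> 'b" where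
  "sweep P H f 0 = f"
| "sweep P H f (Suc m) = P (H (Suc m)) (sweep P H f m)"

primrec sweeps :: "('h \<Rightarrow> 'b \<Rightarrow> 'b) \<Rightarrow> (nat \<Rightarrow> 'h) \<Rightarrow> 'b \<Rightarrow> nat \<Rightarrow> 'b" where
  "sweeps P H f 0 = f"
| "sweeps P H f (Suc n) = sweep P H (sweeps P H f n) (Suc n)"

lemma sweep_rel:
  assumes "R f g" "\<And>n f g. n \<ge> 1 \<Longrightarrow> R f g \<Longrightarrow> R (P (H n) f) (Q (H n) g)"
  shows "R (sweep P H f m) (sweep Q H g m)"
  using assms by (induction m) auto

lemma sweeps_rel:
  assumes "R f g" "\<And>n f g. n \<ge> 1 \<Longrightarrow> R f g \<Longrightarrow> R (P (H n) f) (Q (H n) g)"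
  shows "R (sweeps P H f n) (sweeps Q H g n)"
proof (induction n)
  case 0
  then show ?case using assms by simp
next
  case (Suc n)
  then show ?case
    unfolding sweeps.simps by (rule sweep_rel) (rule assms(2))
qed

lemma sweeps_invariant:
  assumes "I f" "\<And>n f. n \<ge> 1 \<Longrightarrow> I f \<Longrightarrow> I (P (H n) f)"
  shows "I (sweeps P H f n)"
  using sweeps_rel[where R = "\<lambda>f g. I f" and P = P and Q = P] assms by metis

lemma polarize_list_eq_sweep: "polarize_list (map H [1..<Suc m]) f = sweep polarize H f m"
  by (induction m) (simp_all add: polarize_list_def)

lemma superlevel_sweeps:
  assumes "\<And>a b. Q a \<Longrightarrow> a \<le> b \<Longrightarrow> Q b"
  shows "{x. Q (sweeps polarize H f n x)} = sweeps polarize_set H {x. Q (f x)} n"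
  by (rule sweeps_rel[where R = "\<lambda>f A. {x. Q (f x)} = A"])
     (simp_all add: upward_closed_polarize[of Q, OF assms])

lemma sweeps_set_mono: "A \<subseteq> B \<Longrightarrow> sweeps polarize_set H A n \<subseteq> sweeps polarize_set H B n"
  by (rule sweeps_rel[where R = "(\<subseteq>)"]) (auto intro: polarize_set_mono[THEN subsetD])

lemma sweeps_set_lebesgue:
  assumes "\<And>n. n \<ge> 1 \<Longrightarrow> closed_halfspace (H n)" "A \<in> sets lebesgue"
  shows "sweeps polarize_set H A n \<in> sets lebesgue"
  by (rule sweeps_invariant[where I = "\<lambda>A. A \<in> sets lebesgue"])
     (use assms polarize_set_lebesgue in auto)

lemma emeasure_sweeps_set:
  assumes "\<And>n. n \<ge> 1 \<Longrightarrow> closed_halfspace (H n)" "A \<in> sets lebesgue"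
  shows "emeasure lebesgue (sweeps polarize_set H A n) = emeasure lebesgue A"
proof -
  have "sweeps polarize_set H A n \<in> sets lebesgue
    \<and> emeasure lebesgue (sweeps polarize_set H A n) = emeasure lebesgue A"
    by (rule sweeps_invariant[where I = "\<lambda>B. B \<in> sets lebesgue \<and> emeasure lebesgue B = emeasure lebesgue A"])
       (simp_all add: assms polarize_set_lebesgue emeasure_polarize_set del: emeasure_completion)
  then show ?thesis ..
qed

section \<open>Polarization of Lipschitz bumps\<close>

text \<open>A class of functions that is compact in the uniform norm and stable under polarization.\<close>

definition lipschitz_bump :: "real \<Rightarrow> real \<Rightarrow> real \<Rightarrow> ('a::euclidean_space \<Rightarrow> real) \<Rightarrow> bool" where
  "lipschitz_bump L M R f \<longleftrightarrow> 0 \<le> L \<and> (\<forall>x y. \<bar>f x - f y\<bar> \<le> L * dist x y)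
     \<and> (\<forall>x. 0 \<le> f x \<and> f x \<le> M) \<and> (\<forall>x. R < norm x \<longrightarrow> f x = 0)"

text \<open>Inside \<open>H\<close> the polarized function is a maximum and outside a minimum of two \<open>L\<close>-Lipschitz functions;
for points on different sides \<open>dist_reflection_le\<close> handles the mixed differences. The support
stays in the ball because reflecting a point of \<open>H\<close> moves it away from the origin.\<close>

lemma lipschitz_bump_polarize:
  fixes f :: "'a::euclidean_space \<Rightarrow> real"
  assumes H: "closed_halfspace H" "0 \<in> H" and f: "lipschitz_bump L M R f"
  shows "lipschitz_bump L M R (polarize H f)"
proof -
  let ?s = "reflection H" and ?g = "polarize H f"
  have L: "0 \<le> L" and lip: "\<And>x y. f x - f y \<le> L * dist x y"
    and bd: "\<And>x. 0 \<le> f x" "\<And>x. f x \<le> M" and supp: "\<And>x. R < norm x \<Longrightarrow> f x = 0"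
    using f by (auto simp: lipschitz_bump_def abs_le_iff)
  have far: "f x = 0" if "x \<notin> H" "R < norm (?s x)" for x
    using norm_reflection_le[OF H that(1)] that(2) by (intro supp) simp
  have le: "?g x - ?g y \<le> L * dist x y" for x y
  proof -
    have lips: "f (?s x) - f (?s y) \<le> L * dist x y"
      using lip[of "?s x" "?s y"] dist_reflection[OF H(1)] by simp
    have cross: "f x - f (?s y) \<le> L * dist x y" "f (?s x) - f y \<le> L * dist x y"
      if "x \<in> H" "y \<notin> H"
    proof -
      have "L * dist x (?s y) \<le> L * dist x y"
        using dist_reflection_le[OF H(1) that] L by (intro mult_left_mono)
      then show "f x - f (?s y) \<le> L * dist x y" "f (?s x) - f y \<le> L * dist x y"
        using lip[of x "?s y"] lip[of "?s x" y] by (auto simp: dist_reflection_commute[OF H(1)])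
    qed
    show ?thesis
      using lip[of x y] lips cross by (auto simp: polarize_def max_def min_def)
  qed
  have "\<bar>?g x - ?g y\<bar> \<le> L * dist x y" for x y
    using le[of x y] le[of y x] by (simp add: abs_le_iff dist_commute)
  moreover have "0 \<le> ?g x \<and> ?g x \<le> M" for x
    using bd by (auto simp: polarize_def max_def min_def)
  moreover have "?g x = 0" if "R < norm x" for x
  proof (cases "x \<in> H")
    case True
    then have "R < norm (?s x)"
      using norm_reflection_ge[OF H True] that by simp
    then show ?thesis
      using that True supp by (simp add: polarize_def)
  next
    case False
    then show ?thesis
      using that supp bd(1) by (simp add: polarize_def min_def)
  qed
  ultimately show ?thesis
    using L by (simp add: lipschitz_bump_def)
qed

lemma lipschitz_bump_continuous:
  assumes "lipschitz_bump L M R f"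
  shows "continuous_on UNIV f"
proof -
  have "L-lipschitz_on UNIV f"
    using assms by (intro lipschitz_onI) (auto simp: lipschitz_bump_def dist_real_def)
  then show ?thesis
    by (rule lipschitz_on_continuous_on)
qed

lemma lipschitz_bump_integrable:
  fixes f g :: "'a::euclidean_space \<Rightarrow> real"
  assumes f: "lipschitz_bump L M R f" and g: "continuous_on UNIV g"
  shows "integrable lborel (\<lambda>x. f x * g x)"
proof -
  have "continuous_on (cball 0 R) (\<lambda>x. f x * g x)"
    by (rule continuous_on_subset[OF continuous_on_mult[OF lipschitz_bump_continuous[OF f] g]]) simp
  then have "integrable lborel (\<lambda>x. indicator (cball 0 R) x *\<^sub>R (f x * g x))"
    by (intro borel_integrable_compact) auto
  also have "(\<lambda>x. indicator (cball 0 R) x *\<^sub>R (f x * g x)) = (\<lambda>x. f x * g x)"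
    using f by (auto simp: lipschitz_bump_def fun_eq_iff indicator_def not_le)
  finally show ?thesis .
qed

text \<open>Any strictly increasing radial weight would serve as a Lyapunov function. For the squared norm the gain
\<open>|\<sigma>x|\<^sup>2 - |x|\<^sup>2 = 4 t (t - x \<bullet> \<nu>)\<close> under the reflection \<open>\<sigma>\<close> is linear in the distance from the hyperplane.\<close>

definition second_moment :: "('a::euclidean_space \<Rightarrow> real) \<Rightarrow> real" where
  "second_moment f = (\<integral>x. f x * (norm x)\<^sup>2 \<partial>lborel)"

text \<open>The difference of \<open>f\<close> and its polarization is odd with respect to the reflection, which preserves
Lebesgue measure. Averaging its second moment with that of its mirror image leaves only the
difference of the weights at the two points.\<close>

lemma second_moment_polarize:
  fixes f :: "'a::euclidean_space \<Rightarrow> real"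
  assumes nu: "norm \<nu> = 1" and t: "0 \<le> t" and H: "H = {x. x \<bullet> \<nu> \<le> t}"
    and f: "lipschitz_bump L M R f"
  shows "second_moment f - second_moment (polarize H f)
       = 2 * t * (\<integral>x. (polarize H f x - f x) * (t - x \<bullet> \<nu>) \<partial>lborel)"
proof -
  have half: "closed_halfspace H" "0 \<in> H"
    using nu t by (auto simp: closed_halfspace_def H)
  have nn: "\<nu> \<bullet> \<nu> = 1"
    using nu by (simp add: dot_square_norm)
  have r: "reflection H x = x - (2 * (x \<bullet> \<nu> - t)) *\<^sub>R \<nu>" for x
    using reflection_halfspace[OF nu] H by simp
  let ?s = "reflection H" and ?d = "\<lambda>x. polarize H f x - f x"
  have pf: "lipschitz_bump L M R (polarize H f)"
    using lipschitz_bump_polarize[OF half f] .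
  have int: "integrable lborel (\<lambda>x. ?d x * g x)" if "continuous_on UNIV g" for g :: "'a \<Rightarrow> real"
    using Bochner_Integration.integrable_diff[OF lipschitz_bump_integrable[OF pf that] lipschitz_bump_integrable[OF f that]]
    by (simp add: left_diff_distrib)
  \<comment> \<open>The polarization sorts the two values of \<open>f\<close> at a pair of mirror points and so keeps their sum.\<close>
  have odd: "?d (?s x) = - ?d x" for x
    using reflection_in_halfspace[OF half(1), of x] reflection_notin_halfspace[OF half(1), of x]
      reflection_reflection[OF half(1), of x]
    by (auto simp: polarize_def max_def min_def)
  have norm_s: "(norm (?s x))\<^sup>2 = (norm x)\<^sup>2 + 4 * t * (t - x \<bullet> \<nu>)" for x
  proof -
    have "(norm (?s x))\<^sup>2 = ?s x \<bullet> ?s x"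
      by (simp add: dot_square_norm)
    also have "\<dots> = x \<bullet> x + 4 * t * (t - x \<bullet> \<nu>)"
      by (simp add: r inner_diff_left inner_diff_right nn inner_commute algebra_simps)
    finally show ?thesis by (simp add: dot_square_norm)
  qed
  have [measurable]: "(\<lambda>x. ?d x * (norm x)\<^sup>2) \<in> borel_measurable borel"
    using borel_measurable_integrable[OF int[of "\<lambda>x. (norm x)\<^sup>2"]] by (simp add: continuous_intros)
  have i1: "integrable lborel (\<lambda>x. ?d x * (norm x)\<^sup>2)"
    by (rule int) (intro continuous_intros)
  have i2: "integrable lborel (\<lambda>x. ?d x * (t - x \<bullet> \<nu>))"
    by (rule int) (intro continuous_intros)
  have "(\<integral>x. ?d x * (norm x)\<^sup>2 \<partial>lborel) = (\<integral>x. ?d x * (norm x)\<^sup>2 \<partial>distr lborel borel ?s)"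
    by (simp add: distr_lborel_reflection[OF half(1)])
  also have "\<dots> = (\<integral>x. ?d (?s x) * (norm (?s x))\<^sup>2 \<partial>lborel)"
    using reflection_borel_measurable[OF half(1)] by (intro integral_distr) simp_all
  also have "\<dots> = (\<integral>x. - (?d x * (norm x)\<^sup>2) - 4 * t * (?d x * (t - x \<bullet> \<nu>)) \<partial>lborel)"
    by (simp only: odd norm_s) (simp add: algebra_simps)
  also have "\<dots> = - (\<integral>x. ?d x * (norm x)\<^sup>2 \<partial>lborel) - 4 * t * (\<integral>x. ?d x * (t - x \<bullet> \<nu>) \<partial>lborel)"
    using i1 i2 by simp
  finally have "- (\<integral>x. ?d x * (norm x)\<^sup>2 \<partial>lborel) = 2 * t * (\<integral>x. ?d x * (t - x \<bullet> \<nu>) \<partial>lborel)"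
    by simp
  moreover have "(\<integral>x. ?d x * (norm x)\<^sup>2 \<partial>lborel) = second_moment (polarize H f) - second_moment f"
    unfolding second_moment_def left_diff_distrib
    by (intro Bochner_Integration.integral_diff lipschitz_bump_integrable[OF pf] lipschitz_bump_integrable[OF f] continuous_intros)
  ultimately show ?thesis by simp
qed

lemma polarize_gain_nonneg:
  assumes "H = {x. x \<bullet> \<nu> \<le> t}"
  shows "0 \<le> (polarize H f x - f x) * (t - x \<bullet> \<nu>)"
  using assms by (auto simp: polarize_def mult_nonneg_nonneg mult_nonpos_nonpos)

lemma second_moment_polarize_le:
  assumes H: "closed_halfspace H" "0 \<in> H" and f: "lipschitz_bump L M R f"
  shows "second_moment (polarize H f) \<le> second_moment f"
proof -
  obtain \<nu> t where h: "norm \<nu> = 1" "H = {x. x \<bullet> \<nu> \<le> t}"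
    using H(1) by (auto simp: closed_halfspace_def)
  have t: "0 \<le> t"
    using H(2) h(2) by simp
  have "0 \<le> 2 * t * (\<integral>x. (polarize H f x - f x) * (t - x \<bullet> \<nu>) \<partial>lborel)"
    using t by (intro mult_nonneg_nonneg integral_nonneg_AE AE_I2 polarize_gain_nonneg[OF h(2)]) auto
  then show ?thesis
    using second_moment_polarize[OF h(1) t h(2) f] by simp
qed

lemma continuous_nonneg_integral_zero:
  fixes h :: "'a::euclidean_space \<Rightarrow> real"
  assumes cont: "continuous_on UNIV h" and nonneg: "\<And>x. 0 \<le> h x"
    and int: "integrable lborel h" and zero: "(\<integral>x. h x \<partial>lborel) = 0"
  shows "h x = 0"
proof -
  have "AE x in lborel. h x = 0"
    using integral_nonneg_eq_0_iff_AE[OF int] nonneg zero by simp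
  then have "AE x in lborel. x \<notin> {x. h x \<noteq> 0}"
    by simp
  moreover have op: "open {x. h x \<noteq> 0}"
    using open_Collect_neq[OF cont continuous_on_const] .
  ultimately have "{x. h x \<noteq> 0} \<in> null_sets lborel"
    using AE_iff_null_sets[of "{x. h x \<noteq> 0}" lborel] by simp
  then have "negligible {x. h x \<noteq> 0}"
    by (auto simp: negligible_iff_null_sets null_sets_def)
  then show ?thesis
    using open_not_negligible[OF op] by blast
qed

text \<open>The integrand of the moment loss is continuous and nonnegative, so it vanishes if its integral does.
The loss carries the factor \<open>t\<close>, which is positive precisely because the origin is interior to \<open>H\<close>.
On the hyperplane, where the other factor of the integrand vanishes, both values compared by the
polarization coincide.\<close>

lemma second_moment_polarize_eq:
  fixes f :: "'a::euclidean_space \<Rightarrow> real"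
  assumes H: "H \<in> halfspaces_around_0" and f: "lipschitz_bump L M R f"
    and eq: "second_moment (polarize H f) = second_moment f"
  shows "polarize H f = f"
proof (rule ext)
  fix x :: 'a
  note half = halfspaces_around_0_D[OF H]
  obtain \<nu> t where h: "norm \<nu> = 1" "H = {x. x \<bullet> \<nu> \<le> t}"
    using half(1) by (auto simp: closed_halfspace_def)
  have "\<nu> \<noteq> 0" using h(1) by auto
  then have "interior H = {x. x \<bullet> \<nu> < t}"
    using interior_halfspace_le[of \<nu> t] by (simp add: h(2) inner_commute)
  then have t: "0 < t"
    using H by (simp add: halfspaces_around_0_def)
  let ?h = "\<lambda>x. (polarize H f x - f x) * (t - x \<bullet> \<nu>)"
  have pf: "lipschitz_bump L M R (polarize H f)"
    using lipschitz_bump_polarize[OF half f] .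
  have "?h x = 0"
  proof (rule continuous_nonneg_integral_zero[where h = ?h])
    show "continuous_on UNIV ?h"
      by (intro continuous_intros lipschitz_bump_continuous[OF pf] lipschitz_bump_continuous[OF f])
    show "0 \<le> ?h x" for x
      by (rule polarize_gain_nonneg[OF h(2)])
    show "integrable lborel ?h"
      unfolding left_diff_distrib
      by (intro Bochner_Integration.integrable_diff lipschitz_bump_integrable[OF pf] lipschitz_bump_integrable[OF f] continuous_intros)
    show "(\<integral>x. ?h x \<partial>lborel) = 0"
      using second_moment_polarize[OF h(1) _ h(2) f] t eq by simp
  qed
  then show "polarize H f x = f x"
    using reflection_halfspace[OF h(1), of t x] h(2) by (auto simp: polarize_def)
qed

lemma second_moment_tendsto:
  fixes f :: "nat \<Rightarrow> 'a::euclidean_space \<Rightarrow> real"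
  assumes f: "\<And>k. lipschitz_bump L M R (f k)" and w: "lipschitz_bump L M R w"
    and lim: "\<And>x. (\<lambda>k. f k x) \<longlonglongrightarrow> w x"
  shows "(\<lambda>k. second_moment (f k)) \<longlonglongrightarrow> second_moment w"
  unfolding second_moment_def
proof (rule integral_dominated_convergence)
  let ?b = "\<lambda>x::'a. indicator (cball 0 R) x *\<^sub>R (M * (norm x)\<^sup>2)"
  have sq: "continuous_on UNIV (\<lambda>x::'a. (norm x)\<^sup>2)"
    by (intro continuous_intros)
  show "(\<lambda>x. w x * (norm x)\<^sup>2) \<in> borel_measurable lborel"
    "(\<lambda>x. f k x * (norm x)\<^sup>2) \<in> borel_measurable lborel" for k
    using lipschitz_bump_integrable[OF w sq] lipschitz_bump_integrable[OF f sq] by auto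
  show "integrable lborel ?b"
    by (intro borel_integrable_compact continuous_intros) auto
  show "AE x in lborel. (\<lambda>k. f k x * (norm x)\<^sup>2) \<longlonglongrightarrow> w x * (norm x)\<^sup>2"
    by (intro AE_I2 tendsto_mult lim tendsto_const)
  show "AE x in lborel. norm (f k x * (norm x)\<^sup>2) \<le> ?b x" for k
    using f[of k] by (intro AE_I2) (auto simp: lipschitz_bump_def indicator_def mult_right_mono)
qed

section \<open>Uniform convergence for Lipschitz bumps\<close>

lemma lipschitz_bump_sweep:
  assumes "\<And>n. n \<ge> 1 \<Longrightarrow> H n \<in> halfspaces_around_0" "lipschitz_bump L M R f"
  shows "lipschitz_bump L M R (sweep polarize H f m)"
  by (rule sweep_rel[where R = "\<lambda>f g. lipschitz_bump L M R f"])
     (use assms lipschitz_bump_polarize halfspaces_around_0_D in blast)+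

lemma lipschitz_bump_sweeps:
  assumes "\<And>n. n \<ge> 1 \<Longrightarrow> H n \<in> halfspaces_around_0" "lipschitz_bump L M R f"
  shows "lipschitz_bump L M R (sweeps polarize H f n)"
  by (rule sweeps_invariant[where I = "lipschitz_bump L M R"])
     (use assms lipschitz_bump_polarize halfspaces_around_0_D in blast)+

lemma tendsto_from_uniform:
  assumes "\<And>e. 0 < e \<Longrightarrow> \<exists>N. \<forall>n\<ge>N. \<forall>x. \<bar>f n x - w x\<bar> \<le> (e::real)"
  shows "(\<lambda>n. f n x) \<longlonglongrightarrow> w x"
proof (rule LIMSEQ_I)
  fix r :: real assume "0 < r"
  then obtain N where N: "\<forall>n\<ge>N. \<forall>x. \<bar>f n x - w x\<bar> \<le> r / 2"
    using assms[of "r / 2"] by auto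
  have "norm (f n x - w x) < r" if "n \<ge> N" for n
  proof -
    have "\<bar>f n x - w x\<bar> \<le> r / 2" using N that by blast
    then show ?thesis using \<open>0 < r\<close> by simp
  qed
  then show "\<exists>no. \<forall>n\<ge>no. norm (f n x - w x) < r" by blast
qed

text \<open>Arzela-Ascoli on the ball that supports all functions; outside it the limit is extended by zero, and
the bounds pass to the pointwise limit.\<close>

lemma lipschitz_bump_subsequence:
  fixes f :: "nat \<Rightarrow> 'a::euclidean_space \<Rightarrow> real"
  assumes f: "\<And>n. lipschitz_bump L M R (f n)"
  obtains w k where "lipschitz_bump L M R w" "strict_mono (k :: nat \<Rightarrow> nat)"
    "\<And>e. 0 < e \<Longrightarrow> \<exists>N. \<forall>n\<ge>N. \<forall>x. \<bar>f (k n) x - w x\<bar> \<le> e"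
proof -
  have L: "0 \<le> L"
    using f by (auto simp: lipschitz_bump_def)
  have lip: "\<bar>f n x - f n y\<bar> \<le> L * dist x y" and bd: "0 \<le> f n x" "f n x \<le> M" 
    and supp: "R < norm x \<Longrightarrow> f n x = 0" for n x y
    using f[of n] by (auto simp: lipschitz_bump_def)
  have eqc: "\<exists>d. 0 < d \<and> (\<forall>n y. y \<in> cball 0 R \<and> norm (x - y) < d \<longrightarrow> norm (f n x - f n y) < e)"
    if "0 < e" for x e
  proof (intro exI conjI allI impI)
    show "0 < e / (L + 1)"
      using L that by simp
    fix n y assume y: "y \<in> cball 0 R \<and> norm (x - y) < e / (L + 1)"
    have "norm (f n x - f n y) \<le> (L + 1) * norm (x - y)"
      using lip[of n x y] norm_ge_zero[of "x - y"] by (simp add: dist_norm distrib_right del: norm_ge_zero)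
    also have "\<dots> < e"
      using y L by (simp add: field_simps)
    finally show "norm (f n x - f n y) < e" .
  qed
  obtain g k where k: "strict_mono (k :: nat \<Rightarrow> nat)"
    and g: "\<And>e. 0 < e \<Longrightarrow> \<exists>N. \<forall>n x. n \<ge> N \<and> x \<in> cball 0 R \<longrightarrow> norm (f (k n) x - g x) < e"
    by (rule Arzela_Ascoli[of "cball 0 R" f M]) (use bd eqc in auto)
  define w where "w = (\<lambda>x. if x \<in> cball 0 R then g x else 0)"
  have unif: "\<exists>N. \<forall>n\<ge>N. \<forall>x. \<bar>f (k n) x - w x\<bar> \<le> e" if "0 < e" for e
  proof -
    obtain N where N: "\<forall>n x. n \<ge> N \<and> x \<in> cball 0 R \<longrightarrow> norm (f (k n) x - g x) < e"
      using g[OF \<open>0 < e\<close>] by blast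
    have "\<bar>f (k n) x - w x\<bar> \<le> e" if "n \<ge> N" for n x
      using N[rule_format, of n x] that \<open>0 < e\<close> supp[of x "k n"] by (auto simp: w_def)
    then show ?thesis by blast
  qed
  have lim: "(\<lambda>n. f (k n) x) \<longlonglongrightarrow> w x" for x
    by (rule tendsto_from_uniform[where f = "\<lambda>n. f (k n)" and w = w]) (rule unif)
  have "lipschitz_bump L M R w"
    unfolding lipschitz_bump_def
  proof (intro conjI allI impI L)
    fix x y :: 'a
    show "\<bar>w x - w y\<bar> \<le> L * dist x y"
      by (rule LIMSEQ_le_const2[OF tendsto_rabs[OF tendsto_diff[OF lim lim]]]) (use lip in blast)
    show "0 \<le> w x"
      by (rule LIMSEQ_le_const[OF lim]) (use bd in blast)
    show "w x \<le> M"
      by (rule LIMSEQ_le_const2[OF lim]) (use bd in blast)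
    show "w x = 0" if "R < norm x"
      using that by (simp add: w_def)
  qed
  then show thesis
    using that k unif by blast
qed

lemma polarize_dist_le:
  assumes "\<And>x. \<bar>f x - g x\<bar> \<le> e"
  shows "\<bar>polarize H f x - polarize H g x\<bar> \<le> e"
  using assms[of x] assms[of "reflection H x"] by (auto simp: polarize_def max_def min_def abs_le_iff)

lemma sweep_dist_le:
  assumes "\<forall>x. \<bar>f x - g x\<bar> \<le> e"
  shows "\<forall>x. \<bar>sweep polarize H f m x - sweep polarize H g m x\<bar> \<le> e"
  by (rule sweep_rel[where R = "\<lambda>f g. \<forall>x. \<bar>f x - g x\<bar> \<le> e"])
     (use assms polarize_dist_le in blast)+

lemma second_moment_sweep_antimono:
  assumes H: "\<And>n. n \<ge> 1 \<Longrightarrow> H n \<in> halfspaces_around_0" and f: "lipschitz_bump L M R f"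
    and "i \<le> j"
  shows "second_moment (sweep polarize H f j) \<le> second_moment (sweep polarize H f i)"
  using \<open>i \<le> j\<close>
proof (induction j rule: dec_induct)
  case (step n)
  have "second_moment (sweep polarize H f (Suc n)) \<le> second_moment (sweep polarize H f n)"
    using second_moment_polarize_le[OF _ _ lipschitz_bump_sweep[OF H f, where m = n]] halfspaces_around_0_D[OF H[of "Suc n"]]
    by simp
  then show ?case using step by simp
qed simp

text \<open>Convergence of the second moments along the full sequence forces every prefix of a sweep to keep the
second moment of the subsequential limit \<open>w\<close>. Hence each polarization fixes \<open>w\<close>, and the uniform
distance to a common fixed point cannot increase, so the subsequence pulls the whole sequence to \<open>w\<close>.\<close>

lemma bump_sweeps_limit:
  fixes f :: "'a::euclidean_space \<Rightarrow> real"
  assumes H: "\<And>n. n \<ge> 1 \<Longrightarrow> H n \<in> halfspaces_around_0" and f: "lipschitz_bump L M R f"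
  obtains w where "lipschitz_bump L M R w" "\<And>n. n \<ge> 1 \<Longrightarrow> polarize (H n) w = w"
    "\<And>e. 0 < e \<Longrightarrow> \<exists>N. \<forall>n\<ge>N. \<forall>x. \<bar>sweeps polarize H f n x - w x\<bar> \<le> e"
proof -
  let ?f = "sweeps polarize H f" and ?m = second_moment and ?P = "\<lambda>g. sweep polarize H g"
  have bf: "lipschitz_bump L M R (?f n)" for n
    by (rule lipschitz_bump_sweeps) (use H f in auto)
  obtain w k where w: "lipschitz_bump L M R w" and k: "strict_mono (k :: nat \<Rightarrow> nat)"
    and lim: "\<And>e. 0 < e \<Longrightarrow> \<exists>N. \<forall>n\<ge>N. \<forall>x. \<bar>?f (k n) x - w x\<bar> \<le> e"
    using lipschitz_bump_subsequence[of L M R ?f] bf by blast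
  \<comment> \<open>Every prefix of a sweep has a moment between those before and after the whole sweep.\<close>
  have antimono: "?m (?P (?f n) j) \<le> ?m (?P (?f n) i)" if "i \<le> j" for n i j
    by (rule second_moment_sweep_antimono[OF H bf that])
  have dec: "decseq (\<lambda>n. ?m (?f n))"
  proof (rule decseq_SucI)
    show "?m (?f (Suc n)) \<le> ?m (?f n)" for n
      using antimono[of 0 "Suc n" n] by simp
  qed
  have "0 \<le> ?m (?f n)" for n
    using bf[of n] unfolding second_moment_def
    by (intro integral_nonneg_AE AE_I2) (auto simp: lipschitz_bump_def)
  then obtain m where m: "(\<lambda>n. ?m (?f n)) \<longlonglongrightarrow> m"
    using decseq_convergent[OF dec, of 0] by blast
  \<comment> \<open>For \<open>k n \<ge> j\<close> the first \<open>j\<close> polarizations belong to the sweep that follows \<open>?f (k n)\<close>.\<close>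
  have prefix: "?m (?P w j) = m" for j
  proof -
    have "(\<lambda>n. ?P (?f (k n)) j x) \<longlonglongrightarrow> ?P w j x" for x
    proof (rule tendsto_from_uniform[where f = "\<lambda>n. ?P (?f (k n)) j" and w = "?P w j"])
      fix e :: real assume "0 < e"
      then show "\<exists>N. \<forall>n\<ge>N. \<forall>x. \<bar>?P (?f (k n)) j x - ?P w j x\<bar> \<le> e"
        using lim sweep_dist_le by meson
    qed
    then have "(\<lambda>n. ?m (?P (?f (k n)) j)) \<longlonglongrightarrow> ?m (?P w j)"
      by (intro second_moment_tendsto[of L M R] lipschitz_bump_sweep H bf w) auto
    moreover have "(\<lambda>n. ?m (?P (?f (k n)) j)) \<longlonglongrightarrow> m"
    proof (rule tendsto_sandwich)
      show "\<forall>\<^sub>F n in sequentially. ?m (?f (Suc (k n))) \<le> ?m (?P (?f (k n)) j)"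
        using eventually_ge_at_top[of j]
      proof eventually_elim
        case (elim n)
        then have "j \<le> Suc (k n)"
          using seq_suble[OF k, of n] by simp
        then show ?case
          using antimono[of j "Suc (k n)" "k n"] by simp
      qed
      show "\<forall>\<^sub>F n in sequentially. ?m (?P (?f (k n)) j) \<le> ?m (?f (k n))"
        using antimono[of 0 j] by simp
      show "(\<lambda>n. ?m (?f (k n))) \<longlonglongrightarrow> m"
        using LIMSEQ_subseq_LIMSEQ[OF m k] by (simp add: o_def)
      have "strict_mono (\<lambda>n. Suc (k n))"
        using k by (simp add: strict_mono_def)
      from LIMSEQ_subseq_LIMSEQ[OF m this] show "(\<lambda>n. ?m (?f (Suc (k n)))) \<longlonglongrightarrow> m"
        by (simp add: o_def)
    qed
    ultimately show ?thesis
      by (rule LIMSEQ_unique)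
  qed
  have fix_prefix: "?P w j = w" for j
  proof (induction j)
    case (Suc j)
    have "?m (polarize (H (Suc j)) w) = ?m w"
      using prefix[of "Suc j"] prefix[of 0] Suc by simp
    then have "polarize (H (Suc j)) w = w"
      by (intro second_moment_polarize_eq[OF _ w] H) auto
    then show ?case using Suc by simp
  qed simp
  have inv: "polarize (H n) w = w" if "n \<ge> 1" for n
    using fix_prefix[of n] fix_prefix[of "n - 1"] that by (cases n) auto
  \<comment> \<open>A whole sweep fixes \<open>w\<close> and does not expand uniform distances.\<close>
  have near: "\<forall>x. \<bar>?f n x - w x\<bar> \<le> e" if "n0 \<le> n" "\<forall>x. \<bar>?f n0 x - w x\<bar> \<le> e" for n0 n e
    using that(1)
  proof (induction n rule: dec_induct)
    case (step n)
    then show ?case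
      using sweep_dist_le[of "?f n" w e H "Suc n"] fix_prefix[of "Suc n"] by simp
  qed (rule that(2))
  have "\<exists>N. \<forall>n\<ge>N. \<forall>x. \<bar>?f n x - w x\<bar> \<le> e" if "0 < e" for e
    using lim[OF that] near by (metis order_refl)
  then show thesis
    using that w inv by blast
qed

text \<open>Let \<open>H\<close> be the halfspace of the points closer to \<open>x\<close> than to \<open>y\<close>. It contains the origin since \<open>x\<close> has
the smaller norm, and its reflection swaps \<open>x\<close> and \<open>y\<close>. Invariance under polarizations with respect to
halfspaces tending to \<open>H\<close>, together with continuity, gives the inequality for \<open>H\<close> itself.\<close>

lemma polarize_invariant_radially_antimono:
  fixes w :: "'a::euclidean_space \<Rightarrow> real"
  assumes dense: "halfspaces_dense D halfspaces_containing_0"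
    and D: "\<And>H. H \<in> D \<Longrightarrow> closed_halfspace H" and inv: "\<And>H. H \<in> D \<Longrightarrow> polarize H w = w"
    and cont: "continuous_on UNIV w" and le: "norm x \<le> norm y"
  shows "w y \<le> w x"
proof (cases "x = y")
  case False
  define \<nu> where "\<nu> = (y - x) /\<^sub>R norm (y - x)"
  \<comment> \<open>The hyperplane \<open>{z. z \<bullet> \<nu> = t}\<close> is the perpendicular bisector of \<open>x\<close> and \<open>y\<close>.\<close>
  define t where "t = ((norm y)\<^sup>2 - (norm x)\<^sup>2) / (2 * norm (y - x))"
  let ?H = "{z. z \<bullet> \<nu> \<le> t}"
  have d: "norm (y - x) > 0" using False by simp
  have nu: "norm \<nu> = 1" using d by (simp add: \<nu>_def)
  have t: "0 \<le> t"
    using le by (auto simp: t_def power_mono)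
  have xt: "x \<bullet> \<nu> - t = - norm (y - x) / 2"
  proof -
    have "x \<bullet> \<nu> - t = (2 * (x \<bullet> (y - x)) - ((norm y)\<^sup>2 - (norm x)\<^sup>2)) / (2 * norm (y - x))"
      using d by (simp add: \<nu>_def t_def divide_simps)
    also have "2 * (x \<bullet> (y - x)) - ((norm y)\<^sup>2 - (norm x)\<^sup>2) = - (norm (y - x))\<^sup>2"
      by (simp add: power2_norm_eq_inner inner_diff_left inner_diff_right inner_commute)
    finally show ?thesis
      using d by (simp add: power2_eq_square)
  qed
  have H: "closed_halfspace ?H" "?H \<in> halfspaces_containing_0"
    using nu t by (auto simp: closed_halfspace_def halfspaces_containing_0_def)
  have xH: "x \<in> ?H"
  proof -
    have "x \<bullet> \<nu> - t \<le> 0" using xt d by simp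
    then show ?thesis by simp
  qed
  have "reflection ?H x = x + norm (y - x) *\<^sub>R \<nu>"
    using reflection_halfspace[OF nu, of t x] xt by simp
  then have refl: "reflection ?H x = y"
    using d by (simp add: \<nu>_def)
  obtain G where G: "\<And>k. G k \<in> D" and "halfspace_tendsto G ?H"
    using dense H(2) unfolding halfspaces_dense_def by blast
  then obtain i where i: "\<And>k x y. dist (i k x) (i k y) = dist x y"
    and Gi: "\<And>k::nat. G k = i k ` ?H" and lim: "\<And>x. (\<lambda>k. i k x) \<longlonglongrightarrow> x"
    unfolding halfspace_tendsto_def by auto
  have "w (i k y) \<le> w (i k x)" for k
  proof -
    have "reflection (G k) (i k x) = i k y"
      using reflection_isometry_image[OF i H(1)] Gi refl by simp
    moreover have "i k x \<in> G k"
      using xH Gi by blast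
    ultimately show ?thesis
      using fun_cong[OF inv[OF G[of k]], of "i k x"] by (simp add: polarize_def)
  qed
  moreover have limw: "(\<lambda>k. w (i k z)) \<longlonglongrightarrow> w z" for z
    using continuous_on_tendsto_compose[OF cont lim] by simp
  ultimately show ?thesis
    by (intro LIMSEQ_le[OF limw limw]) blast
qed simp

section \<open>Convergence in measure for sets\<close>

lemma emeasure_lebesgue_ball_le_iff:
  fixes r s :: real
  assumes "0 \<le> r" "0 \<le> s"
  shows "emeasure lebesgue (ball (0::'a::euclidean_space) r) \<le> emeasure lebesgue (ball (0::'a) s) \<longleftrightarrow> r \<le> s"
proof -
  have "0 < measure lborel (ball (0::'a) 1)"
    by (rule content_ball_pos) simp
  moreover have "emeasure lebesgue (ball (0::'a) r) = ennreal (measure lborel (ball (0::'a) r))" for r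
    using emeasure_lborel_ball_finite[of "0::'a" r] by (subst emeasure_eq_ennreal_measure) auto
  ultimately show ?thesis
    using assms by (simp add: content_ball_conv_unit_ball[OF assms(1)] content_ball_conv_unit_ball[OF assms(2)])
qed

lemma ball_of_emeasure:
  assumes "m < \<infinity>"
  obtains r where "0 \<le> r" "emeasure lebesgue (ball (0::'a::euclidean_space) r) = m"
proof
  let ?c = "measure lborel (ball (0::'a) 1)" and ?r = "root DIM('a) (enn2real m / measure lborel (ball (0::'a) 1))"
  have c: "0 < ?c"
    by (rule content_ball_pos) simp
  show r: "0 \<le> ?r"
    using c by simp
  have "emeasure lebesgue (ball (0::'a) ?r) = ennreal (measure lborel (ball (0::'a) ?r))"
    using emeasure_lborel_ball_finite[of "0::'a" ?r] by (subst emeasure_eq_ennreal_measure) auto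
  also have "measure lborel (ball (0::'a) ?r) = enn2real m"
    using c r by (subst content_ball_conv_unit_ball) simp_all
  finally show "emeasure lebesgue (ball (0::'a) ?r) = m"
    using assms by simp
qed

text \<open>A Lebesgue set is a countable union of compact sets up to a null set, and finite subunions exhaust
its measure when this is finite.\<close>

lemma compact_inner_approximation:
  assumes A: "A \<in> sets lebesgue" and fin: "emeasure lebesgue A < \<infinity>" and e: "0 < (e::ennreal)"
  obtains K where "compact K" "K \<subseteq> A" "emeasure lebesgue (A - K) < e"
proof -
  obtain N C where N: "negligible N" and C: "\<And>n::nat. compact (C n)" and AC: "A = (\<Union>n. C n) \<union> N"
    using lebesgue_regular_inner[OF A] by metis
  define K where "K = (\<lambda>n. \<Union>i<n. C i)"
  have K: "compact (K n)" "K n \<subseteq> A" for n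
    using C by (auto simp: K_def AC)
  have "(\<lambda>n. emeasure lebesgue (A - K n)) \<longlonglongrightarrow> emeasure lebesgue (\<Inter>n. A - K n)"
  proof (rule Lim_emeasure_decseq)
    show "range (\<lambda>n. A - K n) \<subseteq> sets lebesgue"
      using A lmeasurable_compact[OF K(1)] by (auto intro!: sets.Diff simp: fmeasurableD)
    show "decseq (\<lambda>n. A - K n)"
      by (auto simp: decseq_def K_def)
    show "emeasure lebesgue (A - K n) \<noteq> \<infinity>" for n
      using emeasure_mono[of "A - K n" A lebesgue] A fin by (auto simp: top_unique)
  qed
  also have "emeasure lebesgue (\<Inter>n. A - K n) = 0"
  proof -
    have "(\<Inter>n. A - K n) \<subseteq> N"
      by (auto simp: AC K_def)
    then have "negligible (\<Inter>n. A - K n)"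
      using N negligible_subset by blast
    then show ?thesis
      by (metis negligible_iff_null_sets null_setsD1)
  qed
  finally obtain n where "emeasure lebesgue (A - K n) < e"
    using order_tendstoD(2)[OF _ e] eventually_sequentially by (metis order_refl)
  then show thesis
    using that K by blast
qed

context
  fixes H :: "nat \<Rightarrow> 'a::euclidean_space set"
  assumes H: "\<And>n. n \<ge> 1 \<Longrightarrow> H n \<in> halfspaces_around_0"
    and dense: "halfspaces_dense (H ` {1..}) halfspaces_containing_0"
begin

lemma sequence_closed_halfspace: "n \<ge> 1 \<Longrightarrow> closed_halfspace (H n)"
  using H halfspaces_around_0_D by blast

text \<open>Let \<open>f = max(0, 1 - dist(x, K))\<close>, so that \<open>K = {f \<ge> 1}\<close>, let \<open>f\<^sub>n\<close> be its iterated polarizations and \<open>w\<close>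
their uniform limit. For large \<open>n\<close> the polarized set \<open>{f\<^sub>n \<ge> 1}\<close> lies in \<open>W = {w > 1 - \<delta>}\<close> and \<open>W\<close> lies in
\<open>{f\<^sub>n > 1 - 2\<delta>}\<close>, a set that has the measure of \<open>{f > 1 - 2\<delta>}\<close> and so is hardly larger than \<open>K\<close>. As \<open>w\<close>
is radially decreasing, \<open>W\<close> and the ball with the measure of \<open>K\<close> are nested, and the part of \<open>W\<close>
outside the ball is small in either case.\<close>

lemma compact_sweeps_escape:
  assumes K: "compact K" and B: "emeasure lebesgue (ball (0::'a) r) = emeasure lebesgue K" and e: "0 < e"
  shows "\<exists>N. \<forall>n\<ge>N. emeasure lebesgue (sweeps polarize_set H K n - ball 0 r) \<le> ennreal e"
proof (cases "K = {}")
  case True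
  have "emeasure lebesgue (sweeps polarize_set H K n - ball 0 r) \<le> ennreal e" for n
  proof -
    have "emeasure lebesgue (sweeps polarize_set H K n - ball 0 r) \<le> emeasure lebesgue (sweeps polarize_set H K n)"
      using True by (intro emeasure_mono sweeps_set_lebesgue[where H = H] sequence_closed_halfspace) auto
    also have "\<dots> = 0"
      using True emeasure_sweeps_set[where H = H, OF sequence_closed_halfspace, where A = "{}" and n = n] by simp
    finally show ?thesis by simp
  qed
  then show ?thesis by blast
next
  case False
  obtain R where R: "\<And>x. x \<in> K \<Longrightarrow> norm x \<le> R"
    using compact_imp_bounded[OF K] by (auto simp: bounded_iff)
  define f where "f = (\<lambda>x::'a. max 0 (1 - infdist x K))"
  have f: "lipschitz_bump 1 1 (R + 1) f"
    unfolding lipschitz_bump_def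
  proof (intro conjI allI impI)
    fix x y
    show "\<bar>f x - f y\<bar> \<le> 1 * dist x y"
      using infdist_triangle_abs[of x K y] by (auto simp: f_def)
    show "0 \<le> f x" "f x \<le> 1"
      using infdist_nonneg[of x K] by (auto simp: f_def)
    show "f x = 0" if "R + 1 < norm x"
    proof -
      obtain y where y: "y \<in> K" "infdist x K = dist x y"
        using infdist_attains_inf[OF compact_imp_closed[OF K] False] by metis
      have "norm x \<le> dist x y + norm y"
        by (metis dist_norm norm_triangle_sub add.commute)
      then show ?thesis
        using y R[OF y(1)] that by (simp add: f_def)
    qed
  qed simp
  have cont: "continuous_on UNIV f"
    using lipschitz_bump_continuous[OF f] .
  have fK: "{x. 1 \<le> f x} = K"
    using in_closed_iff_infdist_zero[OF compact_imp_closed[OF K] False] infdist_nonneg[of _ K]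
    by (auto simp: f_def max_def intro: antisym)
  have C_leb: "{x. c < f x} \<in> sets lebesgue" for c
    using open_Collect_less[OF continuous_on_const cont, of c] by (simp add: borel_open)
  have Kfin: "emeasure lebesgue K < \<infinity>"
    using lmeasurable_compact[OF K] by (simp add: fmeasurable_def del: emeasure_completion)
  \<comment> \<open>The offset 2 keeps \<open>1 - 2 * d j\<close> nonnegative, so that the superlevel sets are bounded.\<close>
  define d where "d = (\<lambda>j::nat. 1 / real (j + 2))"
  have d: "0 < d j" "2 * d j \<le> 1" for j
    by (auto simp: d_def divide_simps)
  have "(\<lambda>j. emeasure lebesgue {x. 1 - 2 * d j < f x}) \<longlonglongrightarrow> emeasure lebesgue (\<Inter>j. {x. 1 - 2 * d j < f x})"
  proof (rule Lim_emeasure_decseq)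
    show "range (\<lambda>j. {x. 1 - 2 * d j < f x}) \<subseteq> sets lebesgue"
      using C_leb by blast
    have "d j \<le> d i" if "i \<le> j" for i j
      using that by (simp add: d_def frac_le)
    then show "decseq (\<lambda>j. {x. 1 - 2 * d j < f x})"
      by (fastforce simp: decseq_def)
    show "emeasure lebesgue {x. 1 - 2 * d j < f x} \<noteq> \<infinity>" for j
    proof -
      have "{x. 1 - 2 * d j < f x} \<subseteq> cball 0 (R + 1)"
      proof
        fix x assume "x \<in> {x. 1 - 2 * d j < f x}"
        then have "f x \<noteq> 0" using d(2)[of j] by auto
        then show "x \<in> cball 0 (R + 1)"
          using f by (force simp: lipschitz_bump_def)
      qed
      then have "emeasure lebesgue {x. 1 - 2 * d j < f x} \<le> emeasure lebesgue (cball (0::'a) (R + 1))"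
        by (intro emeasure_mono) auto
      also have "\<dots> < \<infinity>"
        using emeasure_compact_finite[OF compact_cball] by simp
      finally show ?thesis by simp
    qed
  qed
  also have "(\<Inter>j. {x. 1 - 2 * d j < f x}) = K"
  proof -
    have "d \<longlonglongrightarrow> 0"
      unfolding d_def by real_asymp
    then have "(\<lambda>j. 1 - 2 * d j) \<longlonglongrightarrow> 1 - 2 * 0"
      by (intro tendsto_intros)
    then have "1 \<le> f x" if "\<forall>j. 1 - 2 * d j < f x" for x
      by (intro LIMSEQ_le_const2[of "\<lambda>j. 1 - 2 * d j" 1]) (use that in \<open>auto intro: less_imp_le\<close>)
    moreover have "1 - 2 * d j < f x" if "1 \<le> f x" for j x
      using that d(1)[of j] by simp
    ultimately show ?thesis
      unfolding fK[symmetric] by blast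
  qed
  finally have "\<forall>\<^sub>F j in sequentially. emeasure lebesgue {x. 1 - 2 * d j < f x} < emeasure lebesgue K + ennreal e"
    by (rule order_tendstoD) (use Kfin e in \<open>simp add: ennreal_add_left_cancel_less[of _ 0, simplified]\<close>)
  then obtain j where j: "emeasure lebesgue {x. 1 - 2 * d j < f x} < emeasure lebesgue K + ennreal e"
    by (auto simp: eventually_sequentially)
  obtain w where w: "lipschitz_bump 1 1 (R + 1) w" and inv: "\<And>n. n \<ge> 1 \<Longrightarrow> polarize (H n) w = w"
    and lim: "\<And>e. 0 < e \<Longrightarrow> \<exists>N. \<forall>n\<ge>N. \<forall>x. \<bar>sweeps polarize H f n x - w x\<bar> \<le> e"
    using bump_sweeps_limit[where H = H, OF H f] by blast
  have anti: "w y \<le> w x" if "norm x \<le> norm y" for x y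
    by (rule polarize_invariant_radially_antimono[OF dense _ _ lipschitz_bump_continuous[OF w] that])
       (use sequence_closed_halfspace inv in auto)
  obtain N where N: "\<And>n x. n \<ge> N \<Longrightarrow> \<bar>sweeps polarize H f n x - w x\<bar> \<le> d j / 2"
    using lim[of "d j / 2"] d(1)[of j] by auto
  define W where "W = {x. 1 - d j < w x}"
  have W_leb: "W \<in> sets lebesgue"
    using open_Collect_less[OF continuous_on_const lipschitz_bump_continuous[OF w], of "1 - d j"]
    by (simp add: W_def borel_open)
  have "emeasure lebesgue (sweeps polarize_set H K n - ball 0 r) \<le> ennreal e" if n: "n \<ge> N" for n
  proof -
    have Kn: "sweeps polarize_set H K n = {x. 1 \<le> sweeps polarize H f n x}"
      using superlevel_sweeps[of "\<lambda>y. 1 \<le> y" H f n] by (auto simp: fK)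
    have sub: "sweeps polarize_set H K n \<subseteq> W"
    proof
      fix x assume "x \<in> sweeps polarize_set H K n"
      then show "x \<in> W"
        using abs_le_D1[OF N[OF n, of x]] d(1)[of j] by (simp add: Kn W_def)
    qed
    have "emeasure lebesgue (sweeps polarize_set H K n - ball 0 r) \<le> emeasure lebesgue (W - ball 0 r)"
      using sub W_leb by (intro emeasure_mono) auto
    also have "\<dots> \<le> ennreal e"
    proof (cases "W \<subseteq> ball 0 r")
      case True
      then have "W - ball 0 r = {}" by blast
      then show ?thesis by (simp only: emeasure_empty zero_le)
    next
      case False
      then obtain x where "x \<in> W" "x \<notin> ball 0 r" by blast
      then have x: "x \<in> W" "r \<le> norm x" by auto
      have BW: "ball 0 r \<subseteq> W"
      proof
        fix y :: 'a assume "y \<in> ball 0 r"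
        then show "y \<in> W"
          using x anti[of y x] by (simp add: W_def)
      qed
      have "W \<subseteq> {x. 1 - 2 * d j < sweeps polarize H f n x}"
      proof
        fix x assume "x \<in> W"
        then show "x \<in> {x. 1 - 2 * d j < sweeps polarize H f n x}"
          using abs_le_D2[OF N[OF n, of x]] d(1)[of j] by (simp add: W_def)
      qed
      also have "\<dots> = sweeps polarize_set H {x. 1 - 2 * d j < f x} n"
        by (rule superlevel_sweeps) simp
      finally have "emeasure lebesgue W \<le> emeasure lebesgue (sweeps polarize_set H {x. 1 - 2 * d j < f x} n)"
        by (rule emeasure_mono) (rule sweeps_set_lebesgue[where H = H, OF sequence_closed_halfspace C_leb])
      also have "\<dots> = emeasure lebesgue {x. 1 - 2 * d j < f x}"
        by (rule emeasure_sweeps_set[where H = H, OF sequence_closed_halfspace C_leb])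
      also have "\<dots> \<le> emeasure lebesgue (ball (0::'a) r) + ennreal e"
        using j B by simp
      finally have W_le: "emeasure lebesgue W \<le> emeasure lebesgue (ball (0::'a) r) + ennreal e" .
      have "emeasure lebesgue (ball (0::'a) r) + emeasure lebesgue (W - ball 0 r) = emeasure lebesgue W"
        using W_leb BW
        by (subst plus_emeasure) (auto simp del: emeasure_completion intro!: arg_cong[of _ _ "emeasure lebesgue"])
      then have "emeasure lebesgue (ball (0::'a) r) + emeasure lebesgue (W - ball 0 r)
          \<le> emeasure lebesgue (ball (0::'a) r) + ennreal e"
        using W_le by (simp only:)
      then show ?thesis
        using Kfin B by (auto simp: ennreal_add_left_cancel_le simp del: emeasure_completion)
    qed
    finally show ?thesis .
  qed
  then show ?thesis by blast
qed

text \<open>Replacing \<open>A\<close> by a compact subset \<open>K\<close> changes the measure of each polarized set by the measure of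
\<open>A - K\<close>, and the ball belonging to \<open>K\<close> is contained in the one belonging to \<open>A\<close>.\<close>

lemma sweeps_set_escape:
  assumes A: "A \<in> sets lebesgue" "emeasure lebesgue A < \<infinity>" and r: "0 \<le> r"
    and B: "emeasure lebesgue (ball (0::'a) r) = emeasure lebesgue A" and e: "0 < e"
  shows "\<exists>N. \<forall>n\<ge>N. emeasure lebesgue (sweeps polarize_set H A n - ball 0 r) \<le> ennreal e"
proof -
  obtain K where K: "compact K" "K \<subseteq> A" and AK: "emeasure lebesgue (A - K) < ennreal (e / 2)"
    using compact_inner_approximation[OF A, of "ennreal (e / 2)"] e by auto
  have K_leb: "K \<in> sets lebesgue" and Kfin: "emeasure lebesgue K < \<infinity>"
    using lmeasurable_compact[OF K(1)] by (auto simp: fmeasurable_def)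
  obtain s where s: "0 \<le> s" "emeasure lebesgue (ball (0::'a) s) = emeasure lebesgue K"
    using ball_of_emeasure[OF Kfin] by blast
  have "emeasure lebesgue K \<le> emeasure lebesgue A"
    using K(2) A(1) by (rule emeasure_mono)
  then have sr: "s \<le> r"
    using emeasure_lebesgue_ball_le_iff[OF s(1) r, where 'a = 'a] s(2) B by simp
  obtain N where N: "\<And>n. n \<ge> N \<Longrightarrow> emeasure lebesgue (sweeps polarize_set H K n - ball 0 s) \<le> ennreal (e / 2)"
    using compact_sweeps_escape[OF K(1) s(2), of "e / 2"] e by auto
  have "emeasure lebesgue (sweeps polarize_set H A n - ball 0 r) \<le> ennreal e" if "n \<ge> N" for n
  proof -
    let ?A = "sweeps polarize_set H A n" and ?K = "sweeps polarize_set H K n"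
    have leb: "?A \<in> sets lebesgue" "?K \<in> sets lebesgue"
      using sweeps_set_lebesgue[where H = H, OF sequence_closed_halfspace] A(1) K_leb by auto
    have KA: "?K \<subseteq> ?A"
      by (rule sweeps_set_mono[OF K(2)])
    have "emeasure lebesgue (?A - ball 0 r) \<le> emeasure lebesgue ((?K - ball 0 s) \<union> (?A - ?K))"
      using sr leb by (intro emeasure_mono sets.Un sets.Diff) auto
    also have "\<dots> \<le> emeasure lebesgue (?K - ball 0 s) + emeasure lebesgue (?A - ?K)"
      using leb by (intro emeasure_subadditive) auto
    also have "emeasure lebesgue (?A - ?K) = emeasure lebesgue ?A - emeasure lebesgue ?K"
      using leb KA Kfin emeasure_sweeps_set[where H = H, OF sequence_closed_halfspace K_leb, where n = n]
      by (intro emeasure_Diff) (auto simp del: emeasure_completion)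
    also have "\<dots> = emeasure lebesgue A - emeasure lebesgue K"
      by (simp only: emeasure_sweeps_set[where H = H, OF sequence_closed_halfspace K_leb] emeasure_sweeps_set[where H = H, OF sequence_closed_halfspace A(1)])
    also have "\<dots> = emeasure lebesgue (A - K)"
      using A K_leb K(2) Kfin by (intro emeasure_Diff[symmetric]) auto
    also have "emeasure lebesgue (?K - ball 0 s) + emeasure lebesgue (A - K) \<le> ennreal (e / 2) + ennreal (e / 2)"
      using N[OF that] AK by (intro add_mono) auto
    also have "\<dots> = ennreal e"
      using e by (simp add: ennreal_plus[symmetric] del: ennreal_plus)
    finally show ?thesis .
  qed
  then show ?thesis by blast
qed

text \<open>The polarized set and the ball have equal measures, so the two halves of their symmetric difference
have equal measures too, and \<open>sweeps_set_escape\<close> bounds one of them.\<close>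

lemma sweeps_set_sym_diff_tendsto:
  assumes A: "A \<in> sets lebesgue" "emeasure lebesgue A < \<infinity>" and r: "0 \<le> r"
    and B: "emeasure lebesgue (ball (0::'a) r) = emeasure lebesgue A"
  shows "(\<lambda>n. emeasure lebesgue (sym_diff (sweeps polarize_set H A n) (ball 0 r))) \<longlonglongrightarrow> 0"
proof -
  let ?\<mu> = "emeasure (lebesgue :: 'a measure)" and ?A = "sweeps polarize_set H A" and ?B = "ball (0::'a) r"
  have leb: "?A n \<in> sets lebesgue" for n
    by (rule sweeps_set_lebesgue[where H = H, OF sequence_closed_halfspace A(1)])
  have eq: "?\<mu> (?B - ?A n) = ?\<mu> (?A n - ?B)" for n
  proof -
    have "?\<mu> (?A n \<inter> ?B) + ?\<mu> (?B - ?A n) = ?\<mu> ?B"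
      using leb by (subst plus_emeasure) (auto simp del: emeasure_completion intro!: arg_cong[of _ _ ?\<mu>])
    also have "\<dots> = ?\<mu> (?A n)"
      using B emeasure_sweeps_set[where H = H, OF sequence_closed_halfspace A(1), where n = n] by simp
    also have "\<dots> = ?\<mu> (?A n \<inter> ?B) + ?\<mu> (?A n - ?B)"
      using leb by (subst plus_emeasure) (auto simp del: emeasure_completion intro!: arg_cong[of _ _ ?\<mu>])
    finally have "?\<mu> (?A n \<inter> ?B) + ?\<mu> (?B - ?A n) = ?\<mu> (?A n \<inter> ?B) + ?\<mu> (?A n - ?B)" .
    moreover have "?\<mu> (?A n \<inter> ?B) \<noteq> \<infinity>"
      using emeasure_mono[of "?A n \<inter> ?B" ?B lebesgue] A(2) B by (auto simp: top_unique simp del: emeasure_completion)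
    ultimately show ?thesis
      by (simp add: ennreal_add_left_cancel del: emeasure_completion)
  qed
  have "(\<lambda>n. ?\<mu> (?A n - ?B)) \<longlonglongrightarrow> 0"
  proof (rule tendsto_zero_ennreal)
    fix e :: real assume "0 < e"
    then obtain N where "\<forall>n\<ge>N. ?\<mu> (?A n - ?B) \<le> ennreal (e / 2)"
      using sweeps_set_escape[OF A r B, of "e / 2"] by auto
    moreover have "ennreal (e / 2) < ennreal e"
      using \<open>0 < e\<close> by (simp add: ennreal_less_iff)
    ultimately show "\<forall>\<^sub>F n in sequentially. ?\<mu> (?A n - ?B) < ennreal e"
      unfolding eventually_sequentially by (meson le_less_trans)
  qed
  then have "(\<lambda>n. ?\<mu> (?A n - ?B) + ?\<mu> (?A n - ?B)) \<longlonglongrightarrow> 0 + 0"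
    by (intro tendsto_add)
  moreover have "?\<mu> (sym_diff (?A n) ?B) = ?\<mu> (?A n - ?B) + ?\<mu> (?A n - ?B)" for n
  proof -
    have "?\<mu> (sym_diff (?A n) ?B) = ?\<mu> (?A n - ?B) + ?\<mu> (?B - ?A n)"
      using leb by (intro plus_emeasure[symmetric]) auto
    then show ?thesis
      by (simp only: eq)
  qed
  ultimately show ?thesis
    by (simp del: emeasure_completion)
qed

end

section \<open>The symmetric rearrangement\<close>

lemma superlevel_lebesgue:
  fixes f :: "'a::euclidean_space \<Rightarrow> real"
  assumes "f \<in> borel_measurable lebesgue"
  shows "{x. l < f x} \<in> sets lebesgue"
proof -
  have "{x \<in> space lebesgue. l < f x} \<in> sets lebesgue"
    using assms by measurable
  then show ?thesis by simp
qed

lemma superlevel_finite: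
  assumes p: "1 \<le> p" and u: "in_Lp p u" and l: "0 < l"
  shows "{x. l < u x} \<in> sets lebesgue" "emeasure lebesgue {x. l < u x} < \<infinity>"
proof -
  have m [measurable]: "u \<in> borel_measurable lebesgue" and i: "integrable lebesgue (\<lambda>x. \<bar>u x\<bar> powr p)"
    using u by (auto simp: in_Lp_def)
  show "{x. l < u x} \<in> sets lebesgue"
    by (rule superlevel_lebesgue[OF m])
  have "emeasure lebesgue {x. l < u x} \<le> emeasure lebesgue {x \<in> space lebesgue. 1 \<le> ennreal (1 / l powr p) * ennreal (\<bar>u x\<bar> powr p)}"
  proof (rule emeasure_mono)
    show "{x. l < u x} \<subseteq> {x \<in> space lebesgue. 1 \<le> ennreal (1 / l powr p) * ennreal (\<bar>u x\<bar> powr p)}"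
    proof
      fix x :: 'a assume "x \<in> {x. l < u x}"
      then have "l powr p \<le> \<bar>u x\<bar> powr p"
        using l p by (intro powr_mono2) auto
      then have "1 \<le> 1 / l powr p * \<bar>u x\<bar> powr p"
        using l by (simp add: field_simps)
      then have "ennreal 1 \<le> ennreal (1 / l powr p * \<bar>u x\<bar> powr p)"
        by (rule ennreal_leI)
      also have "\<dots> = ennreal (1 / l powr p) * ennreal (\<bar>u x\<bar> powr p)"
        by (rule ennreal_mult) auto
      finally show "x \<in> {x \<in> space lebesgue. 1 \<le> ennreal (1 / l powr p) * ennreal (\<bar>u x\<bar> powr p)}"
        by simp
    qed
  qed measurable
  also have "\<dots> \<le> ennreal (1 / l powr p) * (\<integral>\<^sup>+x. ennreal (\<bar>u x\<bar> powr p) * indicator (space lebesgue) x \<partial>lebesgue)"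
    by (rule nn_integral_Markov_inequality) measurable
  also have "\<dots> < \<infinity>"
    using i by (simp add: integrable_iff_bounded ennreal_mult_less_top)
  finally show "emeasure lebesgue {x. l < u x} < \<infinity>" .
qed

text \<open>Strictly between two different values there is a positive real level. There both superlevel sets are
balls of the same measure, hence equal, whereas the larger value exceeds the level and the smaller does
not. Applied in both directions this is uniqueness.\<close>

lemma is_symmetric_rearrangement_le:
  fixes u :: "'a::euclidean_space \<Rightarrow> real"
  assumes v: "is_symmetric_rearrangement u v" and v': "is_symmetric_rearrangement u v'"
  shows "v x \<le> v' x"
proof (rule ccontr)
  assume "\<not> v x \<le> v' x"
  then obtain m where m: "v' x < m" "m < v x"
    using dense[of "v' x" "v x"] unfolding not_le by blast
  then obtain l where l: "m = ennreal l" "0 < l"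
  proof -
    have "m \<noteq> top" using m(2) by auto
    then obtain l where l: "m = ennreal l" "0 \<le> l" by (cases m) auto
    have "l \<noteq> 0"
    proof
      assume "l = 0"
      then show False using l(1) m(1) by simp
    qed
    then show thesis using that l by simp
  qed
  obtain r where r: "r \<ge> 0" "{x. ennreal l < v x} = ball 0 r"
    and er: "emeasure lebesgue {x. ennreal l < v x} = emeasure lebesgue {x. l < u x}"
    using v l unfolding is_symmetric_rearrangement_def by blast
  obtain s where s: "s \<ge> 0" "{x. ennreal l < v' x} = ball 0 s"
    and es: "emeasure lebesgue {x. ennreal l < v' x} = emeasure lebesgue {x. l < u x}"
    using v' l unfolding is_symmetric_rearrangement_def by blast
  have "r \<le> s"
    using emeasure_lebesgue_ball_le_iff[OF r(1) s(1), where 'a = 'a] er es r s by simp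
  moreover have "x \<in> ball 0 r"
    using m(2) r(2) l by blast
  ultimately have "x \<in> ball 0 s" by simp
  then show False
    using m(1) s(2) l by (metis mem_Collect_eq not_less_iff_gr_or_eq)
qed

text \<open>Let \<open>B\<^sub>l\<close> be the ball with the measure of \<open>{u > l}\<close>. The rearrangement at \<open>x\<close> is the supremum of the levels
whose ball contains \<open>x\<close>. Its superlevel set at \<open>l\<close> is the union of the \<open>B\<^sub>m\<close> with \<open>m > l\<close>, which is all
of \<open>B\<^sub>l\<close> because the measure of \<open>{u > l}\<close> is right-continuous in \<open>l\<close>.\<close>

lemma is_symmetric_rearrangement_exists:
  fixes u :: "'a::euclidean_space \<Rightarrow> real"
  assumes leb: "\<And>l. 0 < l \<Longrightarrow> {x. l < u x} \<in> sets lebesgue"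
    and fin: "\<And>l. 0 < l \<Longrightarrow> emeasure lebesgue {x. l < u x} < \<infinity>"
  shows "\<exists>v. is_symmetric_rearrangement u v"
proof -
  have "\<forall>l. \<exists>r. 0 < l \<longrightarrow> 0 \<le> r \<and> emeasure lebesgue (ball (0::'a) r) = emeasure lebesgue {x. l < u x}"
    using ball_of_emeasure fin by metis
  then obtain r where r: "\<And>l. 0 < l \<Longrightarrow> 0 \<le> r l"
    and er: "\<And>l. 0 < l \<Longrightarrow> emeasure lebesgue (ball (0::'a) (r l)) = emeasure lebesgue {x. l < u x}"
    by metis
  have r_le: "r l' \<le> r l" if "0 < l" "l \<le> l'" for l l'
  proof -
    have "emeasure lebesgue {x. l' < u x} \<le> emeasure lebesgue {x. l < u x}"
      using that leb by (intro emeasure_mono) auto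
    then show ?thesis
      using that emeasure_lebesgue_ball_le_iff[OF r[of l'] r[of l], where 'a = 'a] er[of l] er[of l'] by simp
  qed
  \<comment> \<open>Right-continuity of the radius, from continuity of the measure from below.\<close>
  have r_right: "\<exists>l'>l. s < r l'" if l: "0 < l" and s: "0 \<le> s" "s < r l" for l s
  proof -
    have "(\<lambda>k. emeasure lebesgue {x. l + 1 / real (Suc k) < u x})
        \<longlonglongrightarrow> emeasure lebesgue (\<Union>k. {x. l + 1 / real (Suc k) < u x})"
    proof (rule Lim_emeasure_incseq)
      show "range (\<lambda>k. {x. l + 1 / real (Suc k) < u x}) \<subseteq> sets lebesgue"
        using leb l by (auto simp: add_pos_pos)
      have "1 / real (Suc j) \<le> 1 / real (Suc i)" if "i \<le> j" for i j
        using that by (simp add: frac_le)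
      then show "incseq (\<lambda>k. {x. l + 1 / real (Suc k) < u x})"
        by (fastforce simp: incseq_def)
    qed
    also have "(\<Union>k. {x. l + 1 / real (Suc k) < u x}) = {x. l < u x}"
    proof (intro set_eqI iffI)
      fix x :: 'a assume "x \<in> {x. l < u x}"
      then obtain k where "inverse (real (Suc k)) < u x - l"
        using reals_Archimedean[of "u x - l"] by auto
      then show "x \<in> (\<Union>k. {x. l + 1 / real (Suc k) < u x})"
        by (auto simp: inverse_eq_divide algebra_simps intro!: exI[of _ k])
    next
      fix x :: 'a assume "x \<in> (\<Union>k. {x. l + 1 / real (Suc k) < u x})"
      then obtain k where "l + 1 / real (Suc k) < u x" by auto
      moreover have "0 < 1 / real (Suc k)" by simp
      ultimately show "x \<in> {x. l < u x}"
        by (smt (verit) mem_Collect_eq)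
    qed
    finally have "\<forall>\<^sub>F k in sequentially. emeasure lebesgue (ball (0::'a) s) < emeasure lebesgue {x. l + 1 / real (Suc k) < u x}"
    proof (rule order_tendstoD)
      show "emeasure lebesgue (ball (0::'a) s) < emeasure lebesgue {x. l < u x}"
        using emeasure_lebesgue_ball_le_iff[OF r[OF l] s(1), where 'a = 'a] s(2) er[OF l] by (simp add: not_le[symmetric])
    qed
    then obtain k where k: "emeasure lebesgue (ball (0::'a) s) < emeasure lebesgue {x. l + 1 / real (Suc k) < u x}"
      by (auto simp: eventually_sequentially)
    define l' where "l' = l + 1 / real (Suc k)"
    have l': "l < l'" by (simp add: l'_def)
    moreover have "s < r l'"
    proof (rule ccontr)
      assume "\<not> s < r l'"
      then have "emeasure lebesgue (ball (0::'a) (r l')) \<le> emeasure lebesgue (ball (0::'a) s)"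
        using emeasure_lebesgue_ball_le_iff[OF r[of l'] s(1), where 'a = 'a] l l' by simp
      then show False
        using k er[of l'] l l' by (simp add: l'_def[symmetric] del: of_nat_Suc)
    qed
    ultimately show ?thesis by blast
  qed
  define v where "v = (\<lambda>x::'a. SUP l \<in> {l. 0 < l \<and> norm x < r l}. ennreal l)"
  have "{x. ennreal l < v x} = ball 0 (r l)" if l: "0 < l" for l
  proof (intro set_eqI iffI)
    fix x :: 'a assume "x \<in> {x. ennreal l < v x}"
    then obtain l' where "0 < l'" "norm x < r l'" "ennreal l < ennreal l'"
      by (auto simp: v_def less_SUP_iff)
    then show "x \<in> ball 0 (r l)"
      using r_le[OF l, of l'] l by (simp add: ennreal_less_iff)
  next
    fix x :: 'a assume "x \<in> ball 0 (r l)"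
    then obtain l' where "l < l'" "norm x < r l'"
      using r_right[OF l, of "norm x"] by auto
    then show "x \<in> {x. ennreal l < v x}"
      using l by (auto simp: v_def less_SUP_iff ennreal_less_iff intro!: exI[of _ l'])
  qed
  then have "is_symmetric_rearrangement u v"
    unfolding is_symmetric_rearrangement_def using r er by metis
  then show ?thesis by blast
qed

lemma symmetric_rearrangement_is:
  assumes "\<And>l. 0 < l \<Longrightarrow> {x. l < u x} \<in> sets lebesgue"
    and "\<And>l. 0 < l \<Longrightarrow> emeasure lebesgue {x. l < u x} < \<infinity>"
  shows "is_symmetric_rearrangement u (symmetric_rearrangement u)"
proof -
  obtain v where v: "is_symmetric_rearrangement u v"
    using is_symmetric_rearrangement_exists[OF assms] by blast
  show ?thesis
    unfolding symmetric_rearrangement_def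
  proof (rule theI[where P = "is_symmetric_rearrangement u", OF v])
    show "v' = v" if "is_symmetric_rearrangement u v'" for v'
      using is_symmetric_rearrangement_le[OF that v] is_symmetric_rearrangement_le[OF v that]
      by (intro ext antisym)
  qed
qed

section \<open>From level sets to the norm\<close>

lemma sigma_finite_lebesgue: "sigma_finite_measure (lebesgue :: 'a::euclidean_space measure)"
proof
  show "\<exists>A. countable A \<and> A \<subseteq> sets (lebesgue :: 'a measure) \<and> \<Union>A = space lebesgue \<and> (\<forall>a\<in>A. emeasure lebesgue a \<noteq> \<infinity>)"
  proof (intro exI conjI ballI)
    show "\<Union>(range (\<lambda>n::nat. ball (0::'a) n)) = space lebesgue"
      using reals_Archimedean2 by auto
    show "emeasure lebesgue a \<noteq> \<infinity>" if "a \<in> range (\<lambda>n::nat. ball (0::'a) n)" for a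
      using that emeasure_lborel_ball_finite by (fastforce simp: less_top[symmetric])
  qed auto
qed

lemma powr_superadditive:
  fixes a b p :: real
  assumes "1 \<le> p" "0 \<le> a" "0 \<le> b"
  shows "a powr p + b powr p \<le> (a + b) powr p"
proof -
  have split: "x powr p = x * x powr (p - 1)" if "0 \<le> x" for x :: real
    using that by (cases "x = 0") (simp_all add: powr_diff)
  have "a powr p + b powr p = a * a powr (p - 1) + b * b powr (p - 1)"
    using assms split by simp
  also have "\<dots> \<le> a * (a + b) powr (p - 1) + b * (a + b) powr (p - 1)"
    using assms by (intro add_mono mult_left_mono powr_mono2) auto
  also have "\<dots> = (a + b) powr p"
    using assms split[of "a + b"] by (simp add: distrib_right)
  finally show ?thesis .
qed

lemma abs_diff_powr_le:
  fixes a b p :: real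
  assumes "1 \<le> p" "0 \<le> a" "0 \<le> b"
  shows "\<bar>a - b\<bar> powr p \<le> \<bar>a powr p - b powr p\<bar>"
proof (cases "b \<le> a")
  case True
  then show ?thesis
    using powr_superadditive[of p "a - b" b] assms by simp
next
  case False
  then show ?thesis
    using powr_superadditive[of p "b - a" a] assms by simp
qed

text \<open>The levels \<open>s\<close> for which \<open>s powr (1 / p)\<close> lies below exactly one of \<open>a\<close> and \<open>b\<close>. For nonnegative \<open>a\<close> and
\<open>b\<close> this is the interval between \<open>a powr p\<close> and \<open>b powr p\<close>, up to end points.\<close>

definition between_levels :: "real \<Rightarrow> real \<Rightarrow> real \<Rightarrow> real set" where
  "between_levels p a b = {s. 0 < s \<and> min a b \<le> s powr (1 / p) \<and> s powr (1 / p) < max a b}"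

lemma powr_inverse_less_iff:
  fixes p s a :: real
  assumes "0 < p" "0 < s" "0 \<le> a"
  shows "s powr (1 / p) < a \<longleftrightarrow> s < a powr p"
proof
  assume "s powr (1 / p) < a"
  then have "(s powr (1 / p)) powr p < a powr p"
    using assms by (intro powr_less_mono2) auto
  then show "s < a powr p"
    using assms by (simp add: powr_powr)
next
  assume "s < a powr p"
  then have "s powr (1 / p) < (a powr p) powr (1 / p)"
    using assms by (intro powr_less_mono2) auto
  then show "s powr (1 / p) < a"
    using assms by (simp add: powr_powr)
qed

lemma emeasure_between_levels:
  assumes p: "0 < p" and a: "0 \<le> a" and b: "0 \<le> b"
  shows "emeasure lborel (between_levels p a b) = ennreal \<bar>a powr p - b powr p\<bar>"
proof -
  have *: "emeasure lborel (between_levels p a b) = ennreal (a powr p - b powr p)" if "b \<le> a" "0 \<le> b" for a b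
  proof -
    have le: "b powr p \<le> a powr p"
      using that p by (intro powr_mono2) auto
    have "emeasure lborel (between_levels p a b) = emeasure lborel {b powr p..<a powr p}"
    proof (rule emeasure_eq_AE)
      have "AE s in lborel. s \<noteq> (0::real)"
        by (rule AE_lborel_singleton)
      then show "AE s in lborel. s \<in> between_levels p a b \<longleftrightarrow> s \<in> {b powr p..<a powr p}"
      proof eventually_elim
        case (elim s)
        show ?case
        proof (cases "0 < s")
          case True
          have "0 \<le> a" using that by simp
          then show ?thesis
            using True that le powr_inverse_less_iff[OF p True, of a] powr_inverse_less_iff[OF p True, of b]
            by (auto simp: between_levels_def)
        next
          case False
          have "0 \<le> b powr p" by simp
          with False elim have "s < b powr p" by linarith
          with False show ?thesis by (simp add: between_levels_def)
        qed
      qed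
      show "between_levels p a b \<in> sets lborel"
        unfolding between_levels_def by measurable
    qed simp
    then show ?thesis
      using le by simp
  qed
  have "between_levels p a b = between_levels p b a"
    by (auto simp: between_levels_def)
  then show ?thesis
    using *[of b a] *[of a b] a b powr_mono2[of p a b] powr_mono2[of p b a] p
    by (cases "b \<le> a") auto
qed

text \<open>The number \<open>\<bar>a\<^sup>p - b\<^sup>p\<bar>\<close> is the length of the set of levels separating \<open>a\<close> from \<open>b\<close>; integrating over \<open>x\<close>
and exchanging the integrals yields the measures of the symmetric differences.\<close>

lemma layer_cake:
  fixes f g :: "'a::euclidean_space \<Rightarrow> real"
  assumes p: "0 < p" and [measurable]: "f \<in> borel_measurable lebesgue" "g \<in> borel_measurable lebesgue"
    and f: "AE x in lebesgue. 0 \<le> f x" and g: "AE x in lebesgue. 0 \<le> g x"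
  shows "(\<integral>\<^sup>+x. ennreal \<bar>f x powr p - g x powr p\<bar> \<partial>lebesgue)
       = (\<integral>\<^sup>+s. indicator {0<..} s * emeasure lebesgue (sym_diff {x. s powr (1 / p) < f x} {x. s powr (1 / p) < g x}) \<partial>lborel)"
    and "(\<lambda>s. indicator {0<..} s * emeasure lebesgue (sym_diff {x. s powr (1 / p) < f x} {x. s powr (1 / p) < g x}))
       \<in> borel_measurable lborel"
proof -
  interpret L: sigma_finite_measure "lebesgue :: 'a measure" by (rule sigma_finite_lebesgue)
  interpret P: pair_sigma_finite lborel "lebesgue :: 'a measure" ..
  let ?E = "\<lambda>s x. indicator {0<..} s * indicator (sym_diff {x. s powr (1 / p) < f x} {x. s powr (1 / p) < g x}) x :: ennreal"
  have E: "?E s x = indicator (between_levels p (f x) (g x)) s" for s x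
    by (auto simp: between_levels_def indicator_def min_def max_def)
  have meas_eq: "(\<lambda>(s, x). ?E s x) = indicator {z \<in> space (lborel \<Otimes>\<^sub>M lebesgue). 0 < fst z \<and>
       min (f (snd z)) (g (snd z)) \<le> fst z powr (1 / p) \<and> fst z powr (1 / p) < max (f (snd z)) (g (snd z))}"
    by (auto simp: fun_eq_iff indicator_def space_pair_measure min_def max_def)
  have E_meas: "(\<lambda>(s, x). ?E s x) \<in> borel_measurable (lborel \<Otimes>\<^sub>M lebesgue)"
    unfolding meas_eq by measurable
  have slice: "(\<integral>\<^sup>+x. ?E s x \<partial>lebesgue)
     = indicator {0<..} s * emeasure lebesgue (sym_diff {x. s powr (1 / p) < f x} {x. s powr (1 / p) < g x})" for s
  proof -
    have "sym_diff {x. s powr (1 / p) < f x} {x. s powr (1 / p) < g x} \<in> sets lebesgue"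
      by (intro sets.Un sets.Diff superlevel_lebesgue) fact+
    then show ?thesis
      by (rule nn_integral_cmult_indicator)
  qed
  have "(\<integral>\<^sup>+x. ennreal \<bar>f x powr p - g x powr p\<bar> \<partial>lebesgue) = (\<integral>\<^sup>+x. (\<integral>\<^sup>+s. ?E s x \<partial>lborel) \<partial>lebesgue)"
  proof (rule nn_integral_cong_AE)
    show "AE x in lebesgue. ennreal \<bar>f x powr p - g x powr p\<bar> = (\<integral>\<^sup>+s. ?E s x \<partial>lborel)"
      using f g
    proof eventually_elim
      case (elim x)
      have "between_levels p (f x) (g x) \<in> sets lborel"
        unfolding between_levels_def by measurable
      then show ?case
        unfolding E using emeasure_between_levels[OF p elim] by simp
    qed
  qed
  also have "\<dots> = (\<integral>\<^sup>+s. (\<integral>\<^sup>+x. ?E s x \<partial>lebesgue) \<partial>lborel)"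
    by (rule P.Fubini'[OF E_meas])
  finally show "(\<integral>\<^sup>+x. ennreal \<bar>f x powr p - g x powr p\<bar> \<partial>lebesgue)
       = (\<integral>\<^sup>+s. indicator {0<..} s * emeasure lebesgue (sym_diff {x. s powr (1 / p) < f x} {x. s powr (1 / p) < g x}) \<partial>lborel)"
    unfolding slice .
  have "(\<lambda>s. \<integral>\<^sup>+x. ?E s x \<partial>lebesgue) \<in> borel_measurable lborel"
    by (rule L.borel_measurable_nn_integral[OF E_meas])
  then show "(\<lambda>s. indicator {0<..} s * emeasure lebesgue (sym_diff {x. s powr (1 / p) < f x} {x. s powr (1 / p) < g x}))
       \<in> borel_measurable lborel"
    unfolding slice .
qed

text \<open>Take one of the two functions in \<open>layer_cake\<close> to be zero: only the measures of the superlevel sets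
enter.\<close>

lemma nn_integral_powr_equimeasurable:
  fixes f g :: "'a::euclidean_space \<Rightarrow> real"
  assumes p: "0 < p" and f: "f \<in> borel_measurable lebesgue" "AE x in lebesgue. 0 \<le> f x"
    and g: "g \<in> borel_measurable lebesgue" "AE x in lebesgue. 0 \<le> g x"
    and eq: "\<And>l. 0 < l \<Longrightarrow> emeasure lebesgue {x. l < f x} = emeasure lebesgue {x. l < g x}"
  shows "(\<integral>\<^sup>+x. ennreal (f x powr p) \<partial>lebesgue) = (\<integral>\<^sup>+x. ennreal (g x powr p) \<partial>lebesgue)"
proof -
  have layers: "(\<integral>\<^sup>+x. ennreal (h x powr p) \<partial>lebesgue)
      = (\<integral>\<^sup>+s. indicator {0<..} s * emeasure lebesgue {x. s powr (1 / p) < h x} \<partial>lborel)"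
    if h: "h \<in> borel_measurable lebesgue" "AE x in lebesgue. 0 \<le> h x" for h :: "'a \<Rightarrow> real"
  proof -
    have "\<not> s powr (1 / p) < 0" for s
      using powr_ge_zero[of s "1 / p"] by linarith
    then show ?thesis
      using layer_cake(1)[OF p h(1) _ h(2), of "\<lambda>_. 0"] p by (simp del: emeasure_completion)
  qed
  have "indicator {0<..} s * emeasure lebesgue {x. s powr (1 / p) < f x}
      = indicator {0<..} s * emeasure lebesgue {x. s powr (1 / p) < g x}" for s :: real
    using eq[of "s powr (1 / p)"] by (cases "0 < s") (auto simp del: emeasure_completion)
  then show ?thesis
    unfolding layers[OF f] layers[OF g] by (simp only:)
qed

lemma in_Lp_equimeasurable:
  fixes f g :: "'a::euclidean_space \<Rightarrow> real"
  assumes p: "0 < p" and f: "f \<in> borel_measurable lebesgue" "AE x in lebesgue. 0 \<le> f x"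
    and g: "in_Lp p g" "AE x in lebesgue. 0 \<le> g x"
    and eq: "\<And>l. 0 < l \<Longrightarrow> emeasure lebesgue {x. l < f x} = emeasure lebesgue {x. l < g x}"
  shows "in_Lp p f"
proof -
  have gm: "g \<in> borel_measurable lebesgue" and gi: "integrable lebesgue (\<lambda>x. \<bar>g x\<bar> powr p)"
    using g(1) by (auto simp: in_Lp_def)
  have abs: "(\<integral>\<^sup>+x. ennreal (\<bar>h x\<bar> powr p) \<partial>lebesgue) = (\<integral>\<^sup>+x. ennreal (h x powr p) \<partial>lebesgue)"
    if "AE x in lebesgue. 0 \<le> h x" for h :: "'a \<Rightarrow> real"
    by (rule nn_integral_cong_AE) (use that in \<open>eventually_elim, simp\<close>)
  have "(\<integral>\<^sup>+x. ennreal (\<bar>f x\<bar> powr p) \<partial>lebesgue) = (\<integral>\<^sup>+x. ennreal (\<bar>g x\<bar> powr p) \<partial>lebesgue)"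
    unfolding abs[OF f(2)] abs[OF g(2)] by (rule nn_integral_powr_equimeasurable[OF p f gm g(2) eq])
  also have "\<dots> < \<infinity>"
    using gi by (simp add: integrable_iff_bounded)
  finally have "(\<integral>\<^sup>+x. ennreal (\<bar>f x\<bar> powr p) \<partial>lebesgue) < \<infinity>" .
  moreover have "(\<lambda>x. \<bar>f x\<bar> powr p) \<in> borel_measurable lebesgue"
    using f(1) by measurable
  ultimately show ?thesis
    using f(1) by (simp add: in_Lp_def integrable_iff_bounded)
qed

text \<open>By \<open>abs_diff_powr_le\<close> and \<open>layer_cake\<close> the integral in question is bounded by an integral over levels
whose integrand tends to zero. Equimeasurability supplies the integrable bound: a symmetric
difference has at most twice the measure of the superlevel set of \<open>g\<close>.\<close>

lemma Lp_norm_tendsto_zero_of_levels: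
  fixes f :: "nat \<Rightarrow> 'a::euclidean_space \<Rightarrow> real" and g u :: "'a \<Rightarrow> real"
  assumes p: "1 \<le> p" and f: "\<And>n. f n \<in> borel_measurable lebesgue" "\<And>n. AE x in lebesgue. 0 \<le> f n x"
    and g: "in_Lp p g" "AE x in lebesgue. 0 \<le> g x"
    and eq: "\<And>l n. 0 < l \<Longrightarrow> emeasure lebesgue {x. l < f n x} = emeasure lebesgue {x. l < g x}"
    and lim: "\<And>l. 0 < l \<Longrightarrow> (\<lambda>n. emeasure lebesgue (sym_diff {x. l < f n x} {x. l < g x})) \<longlonglongrightarrow> 0"
  shows "(\<lambda>n. Lp_norm p (\<lambda>x. f n x - g x)) \<longlonglongrightarrow> 0"
proof -
  have p0: "0 < p" using p by simp
  have gm: "g \<in> borel_measurable lebesgue" and gi: "integrable lebesgue (\<lambda>x. \<bar>g x\<bar> powr p)"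
    using g(1) by (auto simp: in_Lp_def)
  let ?D = "\<lambda>n s. indicator {0<..} s * emeasure lebesgue (sym_diff {x. s powr (1 / p) < f n x} {x. s powr (1 / p) < g x})"
  \<comment> \<open>The layers of \<open>g\<close> against zero, written as in \<open>layer_cake\<close>; the second set is empty.\<close>
  let ?G = "\<lambda>s. indicator {0<..} s * emeasure lebesgue (sym_diff {x. s powr (1 / p) < g x} {x. s powr (1 / p) < 0})"
  have neg: "{x::'a. s powr (1 / p) < 0} = {}" for s
    using powr_ge_zero[of s "1 / p"] by (auto simp: not_less)
  have "(\<lambda>n. \<integral>\<^sup>+s. ?D n s \<partial>lborel) \<longlonglongrightarrow> integral\<^sup>N lborel (\<lambda>s::real. 0)"
  proof (rule nn_integral_dominated_convergence[where u = ?D and u' = "\<lambda>_. 0" and w = "\<lambda>s. 2 * ?G s"])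
    show "?D n \<in> borel_measurable lborel" for n
      by (rule layer_cake(2)[OF p0 f(1) gm f(2) g(2)])
    have Gm: "?G \<in> borel_measurable lborel"
      by (rule layer_cake(2)[OF p0 gm borel_measurable_const g(2)]) simp
    then show "(\<lambda>s. 2 * ?G s) \<in> borel_measurable lborel"
      by measurable
    have "(\<integral>\<^sup>+s. ?G s \<partial>lborel) = (\<integral>\<^sup>+x. ennreal \<bar>g x powr p - 0 powr p\<bar> \<partial>lebesgue)"
      by (rule layer_cake(1)[OF p0 gm borel_measurable_const g(2), symmetric]) simp
    also have "\<dots> = (\<integral>\<^sup>+x. ennreal (\<bar>g x\<bar> powr p) \<partial>lebesgue)"
      by (rule nn_integral_cong_AE) (use g(2) in \<open>eventually_elim, simp\<close>)
    also have "\<dots> < \<infinity>"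
      using gi by (simp add: integrable_iff_bounded)
    finally show "(\<integral>\<^sup>+s. 2 * ?G s \<partial>lborel) < \<infinity>"
      using Gm by (simp add: nn_integral_cmult ennreal_mult_less_top del: emeasure_completion)
    show "AE s in lborel. ?D n s \<le> 2 * ?G s" for n
    proof (rule AE_I2)
      fix s :: real
      let ?F = "{x. s powr (1 / p) < f n x}" and ?H = "{x. s powr (1 / p) < g x}"
      show "?D n s \<le> 2 * ?G s"
      proof (cases "0 < s")
        case True
        have "emeasure lebesgue (sym_diff ?F ?H) \<le> emeasure lebesgue (?F \<union> ?H)"
          using superlevel_lebesgue[OF f(1)] superlevel_lebesgue[OF gm] by (intro emeasure_mono sets.Un) auto
        also have "\<dots> \<le> emeasure lebesgue ?F + emeasure lebesgue ?H"
          using superlevel_lebesgue[OF f(1)] superlevel_lebesgue[OF gm] by (intro emeasure_subadditive) auto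
        also have "\<dots> = 2 * emeasure lebesgue ?H"
          using eq[of "s powr (1 / p)" n] True by (simp add: mult_2 del: emeasure_completion)
        finally show ?thesis
          using True by (simp add: neg del: emeasure_completion)
      next
        case False
        then show ?thesis by (simp del: emeasure_completion)
      qed
    qed
    show "AE s in lborel. (\<lambda>n. ?D n s) \<longlonglongrightarrow> 0"
    proof (rule AE_I2)
      fix s :: real
      show "(\<lambda>n. ?D n s) \<longlonglongrightarrow> 0"
        using lim[of "s powr (1 / p)"] by (cases "0 < s") (auto simp del: emeasure_completion)
    qed
  qed measurable
  moreover have "integral\<^sup>N lborel (\<lambda>s::real. 0) = (0 :: ennreal)"
    by simp
  ultimately have D: "(\<lambda>n. \<integral>\<^sup>+s. ?D n s \<partial>lborel) \<longlonglongrightarrow> 0"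
    by (simp only:)
  have bound: "(\<integral>\<^sup>+x. ennreal (\<bar>f n x - g x\<bar> powr p) \<partial>lebesgue) \<le> (\<integral>\<^sup>+s. ?D n s \<partial>lborel)" for n
  proof -
    have "(\<integral>\<^sup>+x. ennreal (\<bar>f n x - g x\<bar> powr p) \<partial>lebesgue) \<le> (\<integral>\<^sup>+x. ennreal \<bar>f n x powr p - g x powr p\<bar> \<partial>lebesgue)"
    proof (rule nn_integral_mono_AE)
      show "AE x in lebesgue. ennreal (\<bar>f n x - g x\<bar> powr p) \<le> ennreal \<bar>f n x powr p - g x powr p\<bar>"
        using f(2)[of n] g(2) by eventually_elim (intro ennreal_leI abs_diff_powr_le p)
    qed
    also have "\<dots> = (\<integral>\<^sup>+s. ?D n s \<partial>lborel)"
      by (rule layer_cake(1)[OF p0 f(1) gm f(2) g(2)])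
    finally show ?thesis .
  qed
  have nn: "(\<lambda>n. \<integral>\<^sup>+x. ennreal (\<bar>f n x - g x\<bar> powr p) \<partial>lebesgue) \<longlonglongrightarrow> 0"
    by (rule tendsto_sandwich[OF _ _ tendsto_const D]) (simp_all add: bound del: emeasure_completion)
  have "(\<lambda>n. enn2real (\<integral>\<^sup>+x. ennreal (\<bar>f n x - g x\<bar> powr p) \<partial>lebesgue)) \<longlonglongrightarrow> 0"
    by (rule tendsto_enn2real) (simp_all add: nn)
  moreover have "enn2real (\<integral>\<^sup>+x. ennreal (\<bar>f n x - g x\<bar> powr p) \<partial>lebesgue) = (\<integral>x. \<bar>f n x - g x\<bar> powr p \<partial>lebesgue)" for n
    using f(1)[of n] gm by (intro integral_eq_nn_integral[symmetric]) auto
  ultimately have "(\<lambda>n. \<integral>x. \<bar>f n x - g x\<bar> powr p \<partial>lebesgue) \<longlonglongrightarrow> 0"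
    by simp
  then show ?thesis
    unfolding Lp_norm_def using p0
    by (intro tendsto_zero_powrI[where b = "1 / p"]) (auto intro: tendsto_const)
qed

section \<open>Convergence of the iterated polarizations\<close>

lemma nonneg_sweeps:
  fixes u :: "'a::euclidean_space \<Rightarrow> real"
  assumes H: "\<And>n. n \<ge> 1 \<Longrightarrow> closed_halfspace (H n)" and u: "AE x in lebesgue. 0 \<le> u x"
  shows "AE x in lebesgue. 0 \<le> sweeps polarize H u n x"
proof (rule sweeps_invariant[where I = "\<lambda>f. AE x in lebesgue. 0 \<le> f x"])
  fix n :: nat and f :: "'a \<Rightarrow> real"
  assume n: "n \<ge> 1" and f: "AE x in lebesgue. 0 \<le> f x"
  have "AE x in distr lebesgue lebesgue (reflection (H n)). 0 \<le> f x"
    using f by (simp only: distr_lebesgue_reflection[OF H[OF n]])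
  then have "AE x in lebesgue. 0 \<le> f (reflection (H n) x)"
    using AE_distrD[OF reflection_lebesgue_measurable[OF H[OF n]]] by blast
  with f show "AE x in lebesgue. 0 \<le> polarize (H n) f x"
    by eventually_elim (simp add: polarize_def max_def)
qed (rule u)

lemma borel_measurable_sweeps:
  fixes u :: "'a::euclidean_space \<Rightarrow> real"
  assumes H: "\<And>n. n \<ge> 1 \<Longrightarrow> closed_halfspace (H n)" and u: "u \<in> borel_measurable lebesgue"
  shows "sweeps polarize H u n \<in> borel_measurable lebesgue"
  unfolding borel_measurable_iff_greater
proof
  fix l :: real
  have "{x. l < sweeps polarize H u n x} = sweeps polarize_set H {x. l < u x} n"
    by (rule superlevel_sweeps) simp
  also have "\<dots> \<in> sets lebesgue"
    by (rule sweeps_set_lebesgue[where H = H, OF H superlevel_lebesgue[OF u]])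
  finally show "{x \<in> space lebesgue. l < sweeps polarize H u n x} \<in> sets lebesgue"
    by simp
qed

text \<open>The rearrangement is infinite at most on the intersection of all its superlevel sets, whose measures
tend to zero. Away from this null set it has the same superlevel sets as its real-valued version,
which is therefore equimeasurable with \<open>u\<close>.\<close>

lemma symmetric_rearrangement_finite_part:
  fixes u :: "'a::euclidean_space \<Rightarrow> real"
  assumes p: "1 \<le> p" and u: "in_Lp p u" "AE x in lebesgue. 0 \<le> u x"
    and v: "is_symmetric_rearrangement u v"
  shows "AE x in lebesgue. v x \<noteq> \<infinity>"
    and "in_Lp p (\<lambda>x. enn2real (v x))"
    and "\<And>l. 0 < l \<Longrightarrow> AE x in lebesgue. l < enn2real (v x) \<longleftrightarrow> ennreal l < v x"
    and "(\<lambda>x. enn2real (v x)) \<in> borel_measurable lebesgue"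
proof -
  have um: "u \<in> borel_measurable lebesgue"
    using u(1) by (simp add: in_Lp_def)
  have level: "\<exists>r\<ge>0. {x. ennreal l < v x} = ball 0 r"
    and em: "emeasure lebesgue {x. ennreal l < v x} = emeasure lebesgue {x. l < u x}" if "0 < l" for l
    using v that by (auto simp: is_symmetric_rearrangement_def)
  have level_leb: "{x. ennreal l < v x} \<in> sets lebesgue" if "0 < l" for l
    using level[OF that] by auto
  have "(\<lambda>k. emeasure lebesgue {x. real (Suc k) < u x}) \<longlonglongrightarrow> emeasure lebesgue (\<Inter>k. {x. real (Suc k) < u x})"
  proof (rule Lim_emeasure_decseq)
    show "range (\<lambda>k. {x. real (Suc k) < u x}) \<subseteq> sets lebesgue"
      using superlevel_lebesgue[OF um] by blast
    show "decseq (\<lambda>k. {x. real (Suc k) < u x})"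
      by (auto simp: decseq_def)
    show "emeasure lebesgue {x. real (Suc k) < u x} \<noteq> \<infinity>" for k
      using superlevel_finite(2)[OF p u(1), of "real (Suc k)"] by simp
  qed
  also have "(\<Inter>k. {x. real (Suc k) < u x}) = {}"
  proof -
    have "\<not> (\<forall>k. real (Suc k) < u x)" for x
      using reals_Archimedean2[of "u x"] by (metis less_trans lessI of_nat_less_iff not_less_iff_gr_or_eq)
    then show ?thesis by auto
  qed
  finally have lim0: "(\<lambda>k. emeasure lebesgue {x. real (Suc k) < u x}) \<longlonglongrightarrow> 0"
    by simp
  have inf_eq: "{x. v x = \<infinity>} = (\<Inter>k. {x. ennreal (real (Suc k)) < v x})"
  proof (intro set_eqI iffI)
    fix x assume x: "x \<in> (\<Inter>k. {x. ennreal (real (Suc k)) < v x})"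
    show "x \<in> {x. v x = \<infinity>}"
    proof (rule ccontr)
      assume "x \<notin> {x. v x = \<infinity>}"
      then obtain a where a: "v x = ennreal a" "0 \<le> a"
        by (cases "v x") auto
      obtain k where "a < real k"
        using reals_Archimedean2 by blast
      then have "ennreal a \<le> ennreal (real (Suc k))"
        by (intro ennreal_leI) simp
      moreover have "ennreal (real (Suc k)) < v x"
        using x by blast
      ultimately show False
        using a(1) by simp
    qed
  qed auto
  have inf_leb: "{x. v x = \<infinity>} \<in> sets lebesgue"
    unfolding inf_eq by (intro sets.countable_INT) (auto intro!: level_leb simp del: of_nat_Suc)
  have "emeasure lebesgue {x. v x = \<infinity>} \<le> emeasure lebesgue {x. real (Suc k) < u x}" for k
  proof -
    have "emeasure lebesgue {x. v x = \<infinity>} \<le> emeasure lebesgue {x. ennreal (real (Suc k)) < v x}"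
      using level_leb[of "real (Suc k)"] by (intro emeasure_mono) auto
    then show ?thesis
      using em[of "real (Suc k)"] by simp
  qed
  then have "emeasure lebesgue {x. v x = \<infinity>} \<le> 0"
    by (intro LIMSEQ_le_const[OF lim0]) auto
  then have "{x. v x = \<infinity>} \<in> null_sets lebesgue"
    using inf_leb by (simp add: null_sets_def)
  then have "AE x in lebesgue. x \<notin> {x. v x = \<infinity>}"
    by (rule AE_not_in)
  then show fin: "AE x in lebesgue. v x \<noteq> \<infinity>"
    by simp
  show ae: "AE x in lebesgue. l < enn2real (v x) \<longleftrightarrow> ennreal l < v x" if "0 < l" for l
    using fin
  proof eventually_elim
    case (elim x)
    then obtain a where "v x = ennreal a" "0 \<le> a"
      by (cases "v x") auto
    then show ?case
      using that by (simp add: ennreal_less_iff)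
  qed
  have pos_leb: "{x. l < enn2real (v x)} \<in> sets lebesgue" if "0 < l" for l
  proof -
    have "{x. l < enn2real (v x)} = {x. ennreal l < v x} - {x. v x = \<infinity>}"
    proof (intro set_eqI)
      fix x
      show "x \<in> {x. l < enn2real (v x)} \<longleftrightarrow> x \<in> {x. ennreal l < v x} - {x. v x = \<infinity>}"
        using that by (cases "v x") (auto simp: ennreal_less_iff)
    qed
    then show ?thesis
      using level_leb[OF that] inf_leb by (metis sets.Diff)
  qed
  show meas: "(\<lambda>x. enn2real (v x)) \<in> borel_measurable lebesgue"
    unfolding borel_measurable_iff_greater
  proof
    fix l :: real
    show "{x \<in> space lebesgue. l < enn2real (v x)} \<in> sets lebesgue"
    proof (cases "l < 0")
      case True
      then have "{x \<in> space lebesgue. l < enn2real (v x)} = UNIV"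
        by (auto intro: less_le_trans)
      then show ?thesis by simp
    next
      case False
      have "{x \<in> space lebesgue. l < enn2real (v x)} = (\<Union>k. {x. l + 1 / real (Suc k) < enn2real (v x)})"
      proof (intro set_eqI iffI)
        fix x assume "x \<in> {x \<in> space lebesgue. l < enn2real (v x)}"
        then obtain k where "inverse (real (Suc k)) < enn2real (v x) - l"
          using reals_Archimedean[of "enn2real (v x) - l"] by auto
        then show "x \<in> (\<Union>k. {x. l + 1 / real (Suc k) < enn2real (v x)})"
          by (auto simp: inverse_eq_divide algebra_simps intro!: exI[of _ k])
      next
        fix x assume "x \<in> (\<Union>k. {x. l + 1 / real (Suc k) < enn2real (v x)})"
        then obtain k where "l + 1 / real (Suc k) < enn2real (v x)" by auto
        moreover have "0 < 1 / real (Suc k)" by simp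
        ultimately have "l < enn2real (v x)" by linarith
        then show "x \<in> {x \<in> space lebesgue. l < enn2real (v x)}"
          by simp
      qed
      also have "\<dots> \<in> sets lebesgue"
        using pos_leb False by (intro sets.countable_UN) (auto simp: add_nonneg_pos)
      finally show ?thesis .
    qed
  qed
  show "in_Lp p (\<lambda>x. enn2real (v x))"
  proof (rule in_Lp_equimeasurable[OF _ meas _ u])
    show "emeasure lebesgue {x. l < enn2real (v x)} = emeasure lebesgue {x. l < u x}" if "0 < l" for l
    proof -
      have "emeasure lebesgue {x. l < enn2real (v x)} = emeasure lebesgue {x. ennreal l < v x}"
        using ae[OF that] by (intro emeasure_eq_AE pos_leb level_leb that) simp_all
      then show ?thesis
        using em[OF that] by simp
    qed
  qed (use p in simp_all)
qed

theorem theorem1: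
  fixes p :: real
    and u :: "real ^ 'n \<Rightarrow> real"
    and H :: "nat \<Rightarrow> (real ^ 'n) set"
    and v :: "nat \<Rightarrow> real ^ 'n \<Rightarrow> real"
  assumes "1 \<le> p"
    and "in_Lp p u"
    and "AE x in lebesgue. 0 \<le> u x"
    and "\<And>n. n \<ge> 1 \<Longrightarrow> H n \<in> halfspaces_around_0"
    and "v 0 = u"
    and "\<And>n. v (Suc n) = polarize_list (map H [1..<Suc (Suc n)]) (v n)"
    and "halfspaces_dense (H ` {1..}) halfspaces_containing_0"
  shows "Lp_tendsto_ennreal p v (symmetric_rearrangement u)"
proof -
  note p = assms(1) and u = assms(2,3) and H = assms(4) and dense = assms(7)
  have half: "closed_halfspace (H n)" if "n \<ge> 1" for n
    using halfspaces_around_0_D(1)[OF H[OF that]] .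
  have p0: "0 < p" using p by simp
  have um: "u \<in> borel_measurable lebesgue"
    using u(1) by (simp add: in_Lp_def)
  have v: "v n = sweeps polarize H u n" for n
    by (induction n) (simp_all only: assms(5,6) sweeps.simps polarize_list_eq_sweep)
  let ?s = "symmetric_rearrangement u" and ?A = "\<lambda>l. {x. l < u x}"
  let ?g = "\<lambda>x. enn2real (?s x)"
  have s: "is_symmetric_rearrangement u ?s"
    by (rule symmetric_rearrangement_is) (rule superlevel_finite[OF p u(1)], assumption)+
  note fin = symmetric_rearrangement_finite_part[OF p u s]
  have vm: "v n \<in> borel_measurable lebesgue" for n
    unfolding v by (rule borel_measurable_sweeps[where H = H, OF half um])
  have v0: "AE x in lebesgue. 0 \<le> v n x" for n
    unfolding v by (rule nonneg_sweeps[where H = H, OF half u(2)])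
  have levels: "{x. l < v n x} = sweeps polarize_set H (?A l) n" for l n
    unfolding v by (rule superlevel_sweeps) simp
  have v_em: "emeasure lebesgue {x. l < v n x} = emeasure lebesgue (?A l)" for l n
    unfolding levels by (rule emeasure_sweeps_set[where H = H, OF half superlevel_lebesgue[OF um]])
  obtain r where r: "0 \<le> r l" "{x. ennreal l < ?s x} = ball 0 (r l)"
      "emeasure lebesgue (ball (0::real^'n) (r l)) = emeasure lebesgue (?A l)" if "0 < l" for l
    using s unfolding is_symmetric_rearrangement_def by metis
  have ae: "AE x in lebesgue. l < ?g x \<longleftrightarrow> x \<in> ball 0 (r l)" if "0 < l" for l
    using fin(3)[OF that] by eventually_elim (use r(2)[OF that] in blast)
  have g_leb: "{x. l < ?g x} \<in> sets lebesgue" for l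
    by (rule superlevel_lebesgue[OF fin(4)])
  have v_leb: "{x. l < v n x} \<in> sets lebesgue" for l n
    by (rule superlevel_lebesgue[OF vm])
  have g_em: "emeasure lebesgue {x. l < ?g x} = emeasure lebesgue (?A l)" if "0 < l" for l
  proof -
    have "emeasure lebesgue {x. l < ?g x} = emeasure lebesgue (ball (0::real^'n) (r l))"
      using ae[OF that] by (intro emeasure_eq_AE g_leb) simp_all
    then show ?thesis
      using r(3)[OF that] by simp
  qed
  have "(\<lambda>n. Lp_norm p (\<lambda>x. v n x - ?g x)) \<longlonglongrightarrow> 0"
  proof (rule Lp_norm_tendsto_zero_of_levels[OF p vm v0 fin(2)])
    show "AE x in lebesgue. 0 \<le> ?g x" by simp
    show "emeasure lebesgue {x. l < v n x} = emeasure lebesgue {x. l < ?g x}" if "0 < l" for l n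
      using v_em g_em[OF that] by simp
    show "(\<lambda>n. emeasure lebesgue (sym_diff {x. l < v n x} {x. l < ?g x})) \<longlonglongrightarrow> 0" if l: "0 < l" for l
    proof -
      have "emeasure lebesgue (sym_diff {x. l < v n x} {x. l < ?g x})
          = emeasure lebesgue (sym_diff (sweeps polarize_set H (?A l) n) (ball 0 (r l)))" for n
        unfolding levels[symmetric]
        using ae[OF l] v_leb[of l n] g_leb[of l]
        by (intro emeasure_eq_AE sets.Un sets.Diff) auto
      then show ?thesis
        using sweeps_set_sym_diff_tendsto[where H = H, OF H dense superlevel_finite[OF p u(1) l] r(1)[OF l] r(3)[OF l]]
        by (simp del: emeasure_completion)
    qed
  qed
  moreover have "in_Lp p (v n)" for n
    by (rule in_Lp_equimeasurable[OF p0 vm v0 u]) (rule v_em)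
  ultimately show ?thesis
    using fin(1,2) by (simp add: Lp_tendsto_ennreal_def Lp_tendsto_def)
qed

end
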